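(* Let $\Gamma=\mathrm{Cay}(G,S)$ be a connected Cayley graph on the generalized dihedral group $G$ (notation as in the context), where $S\subseteq G\setminus\{e\}$ is inverse-closed, $|S|=4$, and $t\in S$. Then $\Gamma$ admits a perfect code if and only if one of the following holds: (1) there exist $s_0,s_1\in A$ with $S=\{s_1,s_1^{-1},t,ts_0\}$ such that, writing $n=o(s_0)$ and letting $m$ be the least positive integer with $s_1^m\in\langle s_0\rangle$, we have $5\mid n$ and $s_1^m=s_0^{5u/2+m}$ or $s_1^m=s_0^{5u/2-m}$ for some $u\in\{0,2,4,\ldots,2(n/5-1)\}$; (2) there exist $s_0,s_1,s_2\in A$ with $S=\{t,ts_0,ts_1,ts_2\}$ such that, writing $n=o(s_0)$, letting $m$ be the least positive integer with $s_1^m\in\langle s_0\rangle$ and $l$ the least positive integer with $s_2^l\in\langle s_0,s_1\rangle$, we have $5\mid n$ and there exist $v\in\{2,3,4\}$, integers $a,b$ with $\{a,b\}=\{2+\sigma(v),\,v-\sigma(v)-1\}$, $\alpha_1,\alpha_2\in\{0,1,\ldots,n/5-1\}$ and $j\in\{0,1,\ldots,m-1\}$ such that $s_1^{m}=s_0^{5\alpha_1-am}$ and $s_2^{l}=s_0^{5\alpha_2-bl+aj}s_1^{j}$.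
   Context: $A$ is a finite abelian group and $G$ is a finite group containing $A$ as a subgroup of index $2$, together with an involution $t\in G\setminus A$ such that $tat=a^{-1}$ for all $a\in A$ (a generalized dihedral group). $e$ denotes the identity and $o(g)$ the order of $g$. For an inverse-closed $S\subseteq G\setminus\{e\}$, $\mathrm{Cay}(G,S)$ is the graph with vertex set $G$ in which $x,y$ are adjacent iff $yx^{-1}\in S$. A vertex $u$ dominates $v$ if $u=v$ or $u,v$ are adjacent; a set $D$ of vertices is a perfect code if every vertex is dominated by exactly one vertex of $D$. For an integer $k$, $\sigma(k)=(1-(-1)^k)/2$; thus $\{2+\sigma(v),v-\sigma(v)-1\}$ equals $\{2,1\}$, $\{3,1\}$, $\{2,3\}$ for $v=2,3,4$ respectively. *)

theory Defs
  imports "HOL-Algebra.Algebra" "Graph_Theory.Graph_Theory"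
begin

locale generalized_dihedral = group G for G (structure) and A and t +
  assumes finite_carrier: "finite (carrier G)"
    and A_subgroup: "subgroup A G"
    and A_comm: "comm_group (G\<lparr>carrier := A\<rparr>)"
    and A_index: "card (rcosets A) = 2"
    and t_outside: "t \<in> carrier G - A"
    and t_involution: "t \<noteq> \<one>" "t \<otimes> t = \<one>"
    and t_inverts: "a \<in> A \<Longrightarrow> t \<otimes> a \<otimes> t = inv a"

text \<open>
  A simple graph is modelled, as in \<^theory>\<open>Graph_Theory.Digraph\<close>, by a symmetric loop-free
  digraph; the arcs below have these properties when \<open>S\<close> is inverse-closed and
  does not contain \<open>\<one>\<close>.
\<close>

definition cayley_graph :: "('a, 'b) monoid_scheme \<Rightarrow> 'a set \<Rightarrow> ('a, 'a \<times> 'a) pre_digraph" where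
  "cayley_graph G S = with_proj
     \<lparr> pverts = carrier G,
       parcs = {(x, y). x \<in> carrier G \<and> y \<in> carrier G \<and> y \<otimes>\<^bsub>G\<^esub> inv\<^bsub>G\<^esub> x \<in> S} \<rparr>"

text \<open>
  The constant \<^const>\<open>dominates\<close> of the graph library is the arc relation itself; domination
  in the sense of perfect codes also holds between a vertex and itself.
\<close>

definition vertex_dominates :: "('a, 'b) pre_digraph \<Rightarrow> 'a \<Rightarrow> 'a \<Rightarrow> bool" where
  "vertex_dominates \<Gamma> u v \<longleftrightarrow> u = v \<or> u \<rightarrow>\<^bsub>\<Gamma>\<^esub> v"

definition perfect_code :: "('a, 'b) pre_digraph \<Rightarrow> 'a set \<Rightarrow> bool" where
  "perfect_code \<Gamma> D \<longleftrightarrow>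
     D \<subseteq> verts \<Gamma> \<and> (\<forall>v \<in> verts \<Gamma>. \<exists>!u. u \<in> D \<and> vertex_dominates \<Gamma> u v)"

text \<open>
  The least positive exponent that takes \<open>s\<close> into \<open>H\<close>. Such an exponent exists
  whenever \<open>s\<close> has finite order and \<open>H\<close> is a subgroup.
\<close>

definition least_exponent_into :: "('a, 'b) monoid_scheme \<Rightarrow> 'a \<Rightarrow> 'a set \<Rightarrow> nat" where
  "least_exponent_into G s H = (LEAST k::nat. 0 < k \<and> s [^]\<^bsub>G\<^esub> k \<in> H)"

text \<open>
  The natural exponent \<open>\<bar>k\<bar>\<close> has the parity of \<open>k\<close>, and the division by 2 is exact.
\<close>

definition parity_sigma :: "int \<Rightarrow> int" where
  "parity_sigma k = (1 - (-1) ^ nat \<bar>k\<bar>) div 2"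

end

theory Submission
  imports Defs
begin

text \<open>
  Splitting a perfect code into its parts in \<open>A\<close> and in \<open>t A\<close> turns it into a pair of subsets of the
  abelian group \<open>A\<close>, and pulling these back along \<open>(i, j, k) \<mapsto> s0\<^sup>i s1\<^sup>j s2\<^sup>k\<close> gives a periodic perfect
  code of a lattice graph. If \<open>S\<close> has four elements outside \<open>A\<close>, this is the diamond lattice; if it has
  two such elements and \<open>S \<inter> A = {s1, s1\<inverse>}\<close>, it is the square grid. In both graphs a perfect code is
  rigid: the code points near one code point determine all others, and the code is a coset of the
  kernel of a homomorphism onto \<open>\<int>/5\<close>. The period lattice lies in this kernel, so the homomorphism
  descends to \<open>A\<close>, and the arithmetic conditions of the theorem say just that it exists. In all other
  cases \<open>S \<inter> A\<close> contains an involution; averaging over the involutions in \<open>S \<inter> A\<close>, a local argument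
  or a count excludes a perfect code.
\<close>

text \<open>The number 5 is the size of a closed neighbourhood: one coset in \<open>A\<close> and
  one in \<open>t A\<close> of the kernel of a homomorphism to the integers modulo 5 form a code
  when every closed neighbourhood meets the five classes once each. With four elements outside
  \<open>A\<close>, the images of 1, \<open>s0\<close>, \<open>s1\<close>, \<open>s2\<close> must
  then be distinct. Normalised, they are 0, 1, -a, -b, so a and b are distinct elements of {1, 2,
  3}, and the formula with sigma lists just these pairs. In the grid case the images of
  \<open>s0\<close> and \<open>s1\<close> are 1 and +-1. The pull-back is there because
  \<open>A\<close> may have short relations: different words may name the same element, and a local
  argument inside \<open>A\<close> would split into many cases. The code equations involve only
  translates of a point by fixed elements and pass to the lattice unchanged. The relations return at
  the end, as lattice points at which the code must repeat. An involution b in \<open>S\<close>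
  gives an axis of period 2 that joins x to x b. Adding the equations at x and x b removes this axis
  and leaves the coefficient 2 at the centre.\<close>

lemma of_bool_sum5_eq_1:
  "of_bool p + of_bool q + of_bool r + of_bool s + of_bool u = (1::nat) \<longleftrightarrow>
   (p \<or> q \<or> r \<or> s \<or> u) \<and> \<not> (p \<and> q) \<and> \<not> (p \<and> r) \<and> \<not> (p \<and> s) \<and> \<not> (p \<and> u) \<and> \<not> (q \<and> r) \<and> \<not> (q \<and> s)
   \<and> \<not> (q \<and> u) \<and> \<not> (r \<and> s) \<and> \<not> (r \<and> u) \<and> \<not> (s \<and> u)"
  by (auto simp: of_bool_def)

lemma int_translation_closed:
  fixes R :: "int \<Rightarrow> bool"
  assumes "R 0" and "\<And>i. R i \<Longrightarrow> R (i + 1)" and "\<And>i. R i \<Longrightarrow> R (i - 1)"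
  shows "R i"
  by (induction i rule: int_induct[of _ 0]) (use assms in auto)

section \<open>Perfect codes of the diamond lattice\<close>

text \<open>
  The neighbours of a vertex \<open>x\<close> of the first kind are the vertices \<open>x + e\<close> of the second kind, \<open>e\<close> a unit
  vector. The vertices of the first kind with coordinate sum \<open>n\<close> and those of the second kind with sum
  \<open>n + 1\<close> form one copy of the diamond lattice.
\<close>

definition diamond_code :: "(int \<Rightarrow> int \<Rightarrow> int \<Rightarrow> int \<Rightarrow> bool) \<Rightarrow> (int \<Rightarrow> int \<Rightarrow> int \<Rightarrow> int \<Rightarrow> bool) \<Rightarrow> bool" where
  "diamond_code P Q \<longleftrightarrow>
    (\<forall>a b c d. of_bool (P a b c d) + of_bool (Q (a + 1) b c d) + of_bool (Q a (b + 1) c d)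
       + of_bool (Q a b (c + 1) d) + of_bool (Q a b c (d + 1)) = (1::nat)) \<and>
    (\<forall>a b c d. of_bool (Q a b c d) + of_bool (P (a - 1) b c d) + of_bool (P a (b - 1) c d)
       + of_bool (P a b (c - 1) d) + of_bool (P a b c (d - 1)) = (1::nat))"

text \<open>
  With the indices modulo 4, the listed points are \<open>2 e\<^bsub>j+1\<^esub> - e\<^bsub>j\<^esub>\<close> and \<open>e\<^bsub>j+2\<^esub> + e\<^bsub>j+3\<^esub> - e\<^bsub>j\<^esub>\<close>.
\<close>

definition cyclic_pattern :: "(int \<Rightarrow> int \<Rightarrow> int \<Rightarrow> int \<Rightarrow> bool) \<Rightarrow> bool" where
  "cyclic_pattern Q \<longleftrightarrow> Q (-1) 2 0 0 \<and> Q 0 (-1) 2 0 \<and> Q 0 0 (-1) 2 \<and> Q 2 0 0 (-1)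
     \<and> Q (-1) 0 1 1 \<and> Q 1 (-1) 0 1 \<and> Q 1 1 (-1) 0 \<and> Q 0 1 1 (-1)"

text \<open>
  For each \<open>j\<close>, sending \<open>i \<noteq> j\<close> to the \<open>k\<close> with \<open>Q (e\<^bsub>i\<^esub> + e\<^bsub>k\<^esub> - e\<^bsub>j\<^esub>)\<close> is an involution of three indices;
  its fixed point, as a function of \<open>j\<close>, is a 4-cycle, whence the six alternatives.
\<close>

lemma diamond_code_local:
  assumes "diamond_code P Q" and "P 0 0 0 0"
  shows "cyclic_pattern Q \<or> cyclic_pattern (\<lambda>a b c d. Q a b d c) \<or> cyclic_pattern (\<lambda>a b c d. Q a c b d)
   \<or> cyclic_pattern (\<lambda>a b c d. Q a d b c) \<or> cyclic_pattern (\<lambda>a b c d. Q a c d b) \<or> cyclic_pattern (\<lambda>a b c d. Q a d c b)"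
proof -
  note E0 = assms(1)[unfolded diamond_code_def of_bool_sum5_eq_1, THEN conjunct1, rule_format]
  note E1 = assms(1)[unfolded diamond_code_def of_bool_sum5_eq_1, THEN conjunct2, rule_format]
  note p = E0[of 0 0 0 0, simplified]
  note u = E1[of 1 0 0 0, simplified] E1[of 0 1 0 0, simplified] E1[of 0 0 1 0, simplified] E1[of 0 0 0 1, simplified]
  \<comment> \<open>The vertex \<open>e_i - e_j\<close> has the neighbour \<open>e_i\<close> in
    common with the code point at the origin, so neither of the two is a code point. Hence exactly
    one \<open>k\<close> other than \<open>j\<close> satisfies \<open>Q (e_i + e_k - e_j)\<close>, a
    condition symmetric in \<open>i\<close> and \<open>k\<close>.\<close>
  note f = E0[of 1 "-1" 0 0, simplified] E0[of 1 0 "-1" 0, simplified] E0[of 1 0 0 "-1", simplified]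
     E0[of "-1" 1 0 0, simplified] E0[of 0 1 "-1" 0, simplified] E0[of 0 1 0 "-1", simplified]
     E0[of "-1" 0 1 0, simplified] E0[of 0 "-1" 1 0, simplified] E0[of 0 0 1 "-1", simplified]
     E0[of "-1" 0 0 1, simplified] E0[of 0 "-1" 0 1, simplified] E0[of 0 0 "-1" 1, simplified]
  \<comment> \<open>The first-kind vertices at distance four from the origin. Their equations
    exclude everything but the 4-cycles.\<close>
  note c2 =
    E0[of 2 "-1" "-1" 0, simplified] E0[of 2 "-1" 0 "-1", simplified] E0[of 2 0 "-1" "-1", simplified]
    E0[of "-1" 2 "-1" 0, simplified] E0[of "-1" 2 0 "-1", simplified] E0[of 0 2 "-1" "-1", simplified]
    E0[of "-1" "-1" 2 0, simplified] E0[of "-1" 0 2 "-1", simplified] E0[of 0 "-1" 2 "-1", simplified]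
    E0[of "-1" "-1" 0 2, simplified] E0[of "-1" 0 "-1" 2, simplified] E0[of 0 "-1" "-1" 2, simplified]
    E0[of 1 1 "-1" "-1", simplified] E0[of 1 "-1" 1 "-1", simplified] E0[of 1 "-1" "-1" 1, simplified]
    E0[of "-1" 1 1 "-1", simplified] E0[of "-1" 1 "-1" 1, simplified] E0[of "-1" "-1" 1 1, simplified]
  show ?thesis
    unfolding cyclic_pattern_def using assms(2) p u f c2 by (smt (verit))
qed

lemma diamond_code_translate:
  assumes "diamond_code P Q"
  shows "diamond_code (\<lambda>a b c d. P (i + a) (j + b) (k + c) (l + d)) (\<lambda>a b c d. Q (i + a) (j + b) (k + c) (l + d))"
proof -
  have *: "x + (y + 1) = (x + y) + 1" "x + (y - 1) = (x + y) - 1" for x y :: int by simp_all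
  show ?thesis using assms unfolding diamond_code_def * by blast
qed

text \<open>Point reflection exchanges the two kinds of vertices, so results about code points of
  the first kind carry over to the second.\<close>

lemma diamond_code_reflect:
  assumes "diamond_code P Q"
  shows "diamond_code (\<lambda>a b c d. Q (i - a) (j - b) (k - c) (l - d)) (\<lambda>a b c d. P (i - a) (j - b) (k - c) (l - d))"
proof -
  have *: "x - (y + 1) = (x - y) - 1" "x - (y - 1) = (x - y) + 1" for x y :: int by simp_all
  show ?thesis using assms unfolding diamond_code_def * by blast
qed

lemma diamond_code_rotate:
  assumes "diamond_code P Q"
  shows "diamond_code (\<lambda>a b c d. P d a b c) (\<lambda>a b c d. Q d a b c)"
  unfolding diamond_code_def
proof (intro conjI allI, goal_cases)
  case (1 a b c d)
  then show ?case
    using assms[unfolded diamond_code_def, THEN conjunct1, rule_format, of d a b c] by linarith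
next
  case (2 a b c d)
  then show ?case
    using assms[unfolded diamond_code_def, THEN conjunct2, rule_format, of d a b c] by linarith
qed

lemma cyclic_pattern_rotate: "cyclic_pattern (\<lambda>a b c d. Q d a b c) \<longleftrightarrow> cyclic_pattern Q"
  unfolding cyclic_pattern_def by auto

text \<open>The code seen backwards from a neighbouring code point has the same 4-cycle.\<close>

lemma cyclic_pattern_rigid_0:
  assumes "diamond_code P Q" and "P 0 0 0 0" and "cyclic_pattern Q"
  shows "cyclic_pattern (\<lambda>a b c d. P (- 1 - a) (2 - b) (- c) (- d))"
    and "cyclic_pattern (\<lambda>a b c d. P (- 1 - a) (- b) (1 - c) (1 - d))"
proof -
  note E0 = assms(1)[unfolded diamond_code_def of_bool_sum5_eq_1, THEN conjunct1, rule_format]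
  note E1 = assms(1)[unfolded diamond_code_def of_bool_sum5_eq_1, THEN conjunct2, rule_format]
  note C = assms(3)[unfolded cyclic_pattern_def]
  note L = diamond_code_local[OF diamond_code_reflect[OF assms(1)]]
  have Q1: "Q (-1) 2 0 0" "Q (-1) 0 1 1" using C by auto
  \<comment> \<open>Seen backwards, the origin lies at the same offset, so index 1 is the fixed
    point belonging to index 0 in both cases. This leaves two of the six 4-cycles, and the equations
    nearby exclude the wrong one.\<close>
  note a = L[of "-1" 2 0 0, simplified, OF Q1(1), unfolded cyclic_pattern_def, simplified]
  note b = L[of "-1" 0 1 1, simplified, OF Q1(2), unfolded cyclic_pattern_def, simplified]
  show "cyclic_pattern (\<lambda>a b c d. P (- 1 - a) (2 - b) (- c) (- d))"
    unfolding cyclic_pattern_def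
    apply simp
    using a C assms(2) E0[of 0 0 0 0, simplified] E1[of 0 1 0 0, simplified] E0[of "-1" 1 1 "-1", simplified]
      E1[of "-1" 2 0 0, simplified] E1[of "-1" 1 1 0, simplified] E1[of "-1" 1 0 1, simplified] E1[of 0 1 1 "-1", simplified]
      E1[of 0 0 1 0, simplified] E1[of 0 0 0 1, simplified] E1[of 1 0 0 0, simplified]
    by (smt (verit))
  show "cyclic_pattern (\<lambda>a b c d. P (- 1 - a) (- b) (1 - c) (1 - d))"
    unfolding cyclic_pattern_def
    apply simp
    using b C assms(2) E0[of 0 0 0 0, simplified] E1[of 0 1 0 0, simplified] E0[of "-1" 1 1 "-1", simplified]
      E1[of "-1" 0 1 1, simplified] E1[of 0 1 1 "-1", simplified]
      E1[of 0 0 1 0, simplified] E1[of 0 0 0 1, simplified] E1[of 1 0 0 0, simplified]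
    by (smt (verit))
qed

definition pattern_offsets :: "(int \<times> int \<times> int \<times> int) set" where
  "pattern_offsets = {(-1, 2, 0, 0), (0, -1, 2, 0), (0, 0, -1, 2), (2, 0, 0, -1),
     (-1, 0, 1, 1), (1, -1, 0, 1), (1, 1, -1, 0), (0, 1, 1, -1)}"

lemma cyclic_pattern_iff: "cyclic_pattern Q \<longleftrightarrow> (\<forall>(a, b, c, d) \<in> pattern_offsets. Q a b c d)"
  unfolding cyclic_pattern_def pattern_offsets_def by simp

text \<open>The eight offsets form two orbits under cyclic shift of the axes, which preserves the
  pattern. The two representatives already treated are transported by zero to three shifts.\<close>

lemma cyclic_pattern_rigid:
  assumes "diamond_code P Q" and "P 0 0 0 0" and "cyclic_pattern Q"
    and "(i, j, k, l) \<in> pattern_offsets"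
  shows "cyclic_pattern (\<lambda>a b c d. P (i - a) (j - b) (k - c) (l - d))"
proof -
  define rot :: "(int \<Rightarrow> int \<Rightarrow> int \<Rightarrow> int \<Rightarrow> bool) \<Rightarrow> int \<Rightarrow> int \<Rightarrow> int \<Rightarrow> int \<Rightarrow> bool"
    where "rot = (\<lambda>P a b c d. P d a b c)"
  have code: "diamond_code (rot P) (rot Q)" if "diamond_code P Q" for P Q
    using diamond_code_rotate[OF that] unfolding rot_def .
  have pat: "cyclic_pattern (rot Q) \<longleftrightarrow> cyclic_pattern Q" for Q
    using cyclic_pattern_rotate unfolding rot_def .
  have orig: "rot P 0 0 0 0 \<longleftrightarrow> P 0 0 0 0" for P
    unfolding rot_def ..
  note r0 = cyclic_pattern_rigid_0[OF assms(1-3)]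
  note r1 = cyclic_pattern_rigid_0[OF code[OF assms(1)], unfolded pat orig, OF assms(2,3)]
  note r2 = cyclic_pattern_rigid_0[OF code[OF code[OF assms(1)]], unfolded pat orig, OF assms(2,3)]
  note r3 = cyclic_pattern_rigid_0[OF code[OF code[OF code[OF assms(1)]]], unfolded pat orig, OF assms(2,3)]
  note r = r0 r1 r2 r3
  show ?thesis
    using assms(4) r unfolding pattern_offsets_def rot_def cyclic_pattern_def by (elim insertE emptyE) simp_all
qed

definition pattern_centre ::
  "(int \<Rightarrow> int \<Rightarrow> int \<Rightarrow> int \<Rightarrow> bool) \<Rightarrow> (int \<Rightarrow> int \<Rightarrow> int \<Rightarrow> int \<Rightarrow> bool) \<Rightarrow> int \<Rightarrow> int \<Rightarrow> int \<Rightarrow> int \<Rightarrow> bool" where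
  "pattern_centre P Q a b c d \<longleftrightarrow>
     P a b c d \<and> cyclic_pattern (\<lambda>i j k l. Q (a + i) (b + j) (c + k) (d + l))"

text \<open>One step out by \<open>x\<close> and one step back by \<open>y\<close>: rigidity is
  applied from the centre, and then, after reflection, from the second-kind code point
  reached.\<close>

lemma pattern_centre_step:
  assumes code: "diamond_code P Q" and "pattern_centre P Q a b c d"
    and x: "(x0, x1, x2, x3) \<in> pattern_offsets" and y: "(y0, y1, y2, y3) \<in> pattern_offsets"
  shows "pattern_centre P Q (a + x0 - y0) (b + x1 - y1) (c + x2 - y2) (d + x3 - y3)"
proof -
  define P' where "P' = (\<lambda>i j k l. P (a + i) (b + j) (c + k) (d + l))"
  define Q' where "Q' = (\<lambda>i j k l. Q (a + i) (b + j) (c + k) (d + l))"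
  define P'' where "P'' = (\<lambda>i j k l. P' (x0 - i) (x1 - j) (x2 - k) (x3 - l))"
  define Q'' where "Q'' = (\<lambda>i j k l. Q' (x0 - i) (x1 - j) (x2 - k) (x3 - l))"
  have c': "diamond_code P' Q'"
    unfolding P'_def Q'_def by (rule diamond_code_translate[OF code])
  have o': "P' 0 0 0 0" "cyclic_pattern Q'"
    using assms(2) unfolding pattern_centre_def P'_def Q'_def by simp_all
  have c'': "diamond_code Q'' P''"
    unfolding P''_def Q''_def by (rule diamond_code_reflect[OF c'])
  have p'': "cyclic_pattern P''"
    unfolding P''_def by (rule cyclic_pattern_rigid[OF c' o' x])
  have "Q' x0 x1 x2 x3"
    using o'(2) x unfolding cyclic_pattern_iff by blast
  then have q'': "Q'' 0 0 0 0"
    unfolding Q''_def by simp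
  have "P'' y0 y1 y2 y3"
    using p'' y unfolding cyclic_pattern_iff by blast
  moreover have "cyclic_pattern (\<lambda>i j k l. Q'' (y0 - i) (y1 - j) (y2 - k) (y3 - l))"
    by (rule cyclic_pattern_rigid[OF c'' q'' p'' y])
  ultimately show ?thesis
    unfolding pattern_centre_def P''_def Q''_def P'_def Q'_def
    by (simp add: algebra_simps)
qed

text \<open>A homomorphism vanishing on all \<open>2 e_(j+1) - e_j\<close> must halve its value from
  one axis to the next. Modulo 5 this is multiplication by 3, which gives the weights 1, 3, 4, 2;
  the other four offsets have weight 0 as well.\<close>

lemma pattern_centre_lattice:
  assumes code: "diamond_code P Q" and orig: "pattern_centre P Q 0 0 0 0"
    and "a + b + c + d = 0" and "5 dvd a + 3 * b + 4 * c + 2 * d"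
  shows "pattern_centre P Q a b c d"
proof -
  let ?C = "pattern_centre P Q"
  have offs: "(0, 0, -1, 2) \<in> pattern_offsets" "(2, 0, 0, -1) \<in> pattern_offsets"
    "(-1, 0, 1, 1) \<in> pattern_offsets" "(1, -1, 0, 1) \<in> pattern_offsets"
    unfolding pattern_offsets_def by simp_all
  note step = pattern_centre_step[OF code]
  \<comment> \<open>The displacements are the differences of the other three offsets with (2, 0, 0,
    -1): (-1, -1, 0, 2), (-2, 0, -1, 3) and (-3, 0, 1, 2). Their last three coordinates have
    determinant 5, so they generate the whole kernel, which has index 5 among the vectors of sum
    0.\<close>
  have 1: "?C (- i) (- i) 0 (2 * i)" for i
  proof (rule int_translation_closed[of "\<lambda>i. ?C (- i) (- i) 0 (2 * i)"])
    fix i assume "?C (- i) (- i) 0 (2 * i)"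
    from step[OF this offs(4,2)] step[OF this offs(2,4)]
    show "?C (- (i + 1)) (- (i + 1)) 0 (2 * (i + 1))" "?C (- (i - 1)) (- (i - 1)) 0 (2 * (i - 1))"
      by (simp_all add: algebra_simps)
  qed (use orig in simp)
  have 2: "?C (- i - 2 * j) (- i) (- j) (2 * i + 3 * j)" for i j
  proof (rule int_translation_closed[of "\<lambda>j. ?C (- i - 2 * j) (- i) (- j) (2 * i + 3 * j)"])
    fix j assume "?C (- i - 2 * j) (- i) (- j) (2 * i + 3 * j)"
    from step[OF this offs(1,2)] step[OF this offs(2,1)]
    show "?C (- i - 2 * (j + 1)) (- i) (- (j + 1)) (2 * i + 3 * (j + 1))"
      "?C (- i - 2 * (j - 1)) (- i) (- (j - 1)) (2 * i + 3 * (j - 1))"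
      by (simp_all add: algebra_simps)
  qed (use 1 in simp)
  have 3: "?C (- i - 2 * j - 3 * k) (- i) (k - j) (2 * i + 3 * j + 2 * k)" for i j k
  proof (rule int_translation_closed[of "\<lambda>k. ?C (- i - 2 * j - 3 * k) (- i) (k - j) (2 * i + 3 * j + 2 * k)"])
    fix k assume "?C (- i - 2 * j - 3 * k) (- i) (k - j) (2 * i + 3 * j + 2 * k)"
    from step[OF this offs(3,2)] step[OF this offs(2,3)]
    show "?C (- i - 2 * j - 3 * (k + 1)) (- i) (k + 1 - j) (2 * i + 3 * j + 2 * (k + 1))"
      "?C (- i - 2 * j - 3 * (k - 1)) (- i) (k - 1 - j) (2 * i + 3 * j + 2 * (k - 1))"
      by (simp_all add: algebra_simps)
  qed (use 2 in simp)
  from assms(4) obtain e where e: "a + 3 * b + 4 * c + 2 * d = 5 * e"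
    by (auto elim: dvdE)
  have a: "a = - b - c - d"
    using assms(3) by simp
  have d: "d = 5 * e - 2 * b - 3 * c"
    using e a by simp
  show ?thesis
    using 3[of "- b" "e - c" e] unfolding a d by (simp add: algebra_simps)
qed

text \<open>All second-kind points of sum 1 and weight 0 are code points. Since 1, 3, 4, 2 are all
  the nonzero residues, a first-kind point of sum 0 and nonzero weight has such a neighbour and
  cannot be a code point itself.\<close>

lemma cyclic_pattern_imp_lattice:
  assumes code: "diamond_code P Q" and "P 0 0 0 0" and "cyclic_pattern Q"
    and P: "P a b c d" and sum: "a + b + c + d = 0"
  shows "5 dvd a + 3 * b + 4 * c + 2 * d"
proof (rule ccontr)
  assume nd: "\<not> ?thesis"
  have orig: "pattern_centre P Q 0 0 0 0"
    using assms(2,3) unfolding pattern_centre_def by simp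
  have Q: "Q (2 + i) j k (l - 1)" if "i + j + k + l = 0" "5 dvd i + 3 * j + 4 * k + 2 * l" for i j k l
    using pattern_centre_lattice[OF code orig that]
    unfolding pattern_centre_def cyclic_pattern_def by (simp add: add.commute)
  have "\<not> Q (a + 1) b c d" "\<not> Q a (b + 1) c d" "\<not> Q a b (c + 1) d" "\<not> Q a b c (d + 1)"
    using code[unfolded diamond_code_def of_bool_sum5_eq_1, THEN conjunct1, rule_format, of a b c d] P
    by auto
  moreover have "5 dvd x \<or> 5 dvd x + 1 \<or> 5 dvd x + 2 \<or> 5 dvd x + 3 \<or> 5 dvd x + 4" for x :: int
    by presburger
  moreover have "a - 1 + 3 * b + 4 * c + 2 * (d + 1) = a + 3 * b + 4 * c + 2 * d + 1"
    "a - 2 + 3 * (b + 1) + 4 * c + 2 * (d + 1) = a + 3 * b + 4 * c + 2 * d + 3"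
    "a - 2 + 3 * b + 4 * (c + 1) + 2 * (d + 1) = a + 3 * b + 4 * c + 2 * d + 4"
    "a - 2 + 3 * b + 4 * c + 2 * (d + 2) = a + 3 * b + 4 * c + 2 * d + 2"
    by simp_all
  moreover have "Q (a + 1) b c d" if "5 dvd a - 1 + 3 * b + 4 * c + 2 * (d + 1)"
    using Q[of "a - 1" b c "d + 1"] that sum by (simp add: add.commute)
  moreover have "Q a (b + 1) c d" if "5 dvd a - 2 + 3 * (b + 1) + 4 * c + 2 * (d + 1)"
    using Q[of "a - 2" "b + 1" c "d + 1"] that sum by (simp add: add.commute)
  moreover have "Q a b (c + 1) d" if "5 dvd a - 2 + 3 * b + 4 * (c + 1) + 2 * (d + 1)"
    using Q[of "a - 2" b "c + 1" "d + 1"] that sum by (simp add: add.commute)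
  moreover have "Q a b c (d + 1)" if "5 dvd a - 2 + 3 * b + 4 * c + 2 * (d + 2)"
    using Q[of "a - 2" b c "d + 2"] that sum by (simp add: add.commute)
  ultimately show False
    using nd by metis
qed

lemma diamond_code_lattice:
  assumes code: "diamond_code P Q" and orig: "P 0 0 0 0"
  obtains x0 x1 x2 x3 :: int where "distinct [x0, x1, x2, x3]" and "{x0, x1, x2, x3} = {1, 2, 3, 4}"
    and "\<And>a b c d. P a b c d \<Longrightarrow> a + b + c + d = 0 \<Longrightarrow> 5 dvd a * x0 + b * x1 + c * x2 + d * x3"
proof -
  \<comment> \<open>These two transpositions generate all permutations of the last three axes, and
    so reduce the six alternatives to one.\<close>
  have swap_cd: "diamond_code (\<lambda>a b c d. P a b d c) (\<lambda>a b c d. Q a b d c)" if "diamond_code P Q" for P Q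
    unfolding diamond_code_def
  proof (intro conjI allI, goal_cases)
    case (1 a b c d)
    then show ?case
      using that[unfolded diamond_code_def, THEN conjunct1, rule_format, of a b d c] by linarith
  next
    case (2 a b c d)
    then show ?case
      using that[unfolded diamond_code_def, THEN conjunct2, rule_format, of a b d c] by linarith
  qed
  have swap_bc: "diamond_code (\<lambda>a b c d. P a c b d) (\<lambda>a b c d. Q a c b d)" if "diamond_code P Q" for P Q
    unfolding diamond_code_def
  proof (intro conjI allI, goal_cases)
    case (1 a b c d)
    then show ?case
      using that[unfolded diamond_code_def, THEN conjunct1, rule_format, of a c b d] by linarith
  next
    case (2 a b c d)
    then show ?case
      using that[unfolded diamond_code_def, THEN conjunct2, rule_format, of a c b d] by linarith
  qed
  have perm: "diamond_code (\<lambda>a b c d. P a b d c) (\<lambda>a b c d. Q a b d c)"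
    "diamond_code (\<lambda>a b c d. P a c b d) (\<lambda>a b c d. Q a c b d)"
    "diamond_code (\<lambda>a b c d. P a d b c) (\<lambda>a b c d. Q a d b c)"
    "diamond_code (\<lambda>a b c d. P a c d b) (\<lambda>a b c d. Q a c d b)"
    "diamond_code (\<lambda>a b c d. P a d c b) (\<lambda>a b c d. Q a d c b)"
    using swap_cd[OF code] swap_bc[OF code] swap_cd[OF swap_bc[OF code]]
      swap_bc[OF swap_cd[OF code]] swap_cd[OF swap_bc[OF swap_cd[OF code]]] .
  from diamond_code_local[OF assms] show thesis
  proof (elim disjE, goal_cases)
    case 1
    show ?case
      by (rule that[of 1 3 4 2]) (use cyclic_pattern_imp_lattice[OF code orig 1] in \<open>auto simp: ac_simps\<close>)
  next
    case 2
    have "5 dvd a * 1 + b * 3 + c * 2 + d * 4" if "P a b c d" "a + b + c + d = 0" for a b c d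
      using cyclic_pattern_imp_lattice[OF perm(1) orig 2, where a=a and b=b and c=d and d=c] that by (simp add: ac_simps)
    then show ?case
      by (intro that[of 1 3 2 4]) auto
  next
    case 3
    have "5 dvd a * 1 + b * 4 + c * 3 + d * 2" if "P a b c d" "a + b + c + d = 0" for a b c d
      using cyclic_pattern_imp_lattice[OF perm(2) orig 3, where a=a and b=c and c=b and d=d] that by (simp add: ac_simps)
    then show ?case
      by (intro that[of 1 4 3 2]) auto
  next
    case 4
    have "5 dvd a * 1 + b * 2 + c * 3 + d * 4" if "P a b c d" "a + b + c + d = 0" for a b c d
      using cyclic_pattern_imp_lattice[OF perm(3) orig 4, where a=a and b=c and c=d and d=b] that by (simp add: ac_simps)
    then show ?case
      by (intro that[of 1 2 3 4]) auto
  next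
    case 5
    have "5 dvd a * 1 + b * 4 + c * 2 + d * 3" if "P a b c d" "a + b + c + d = 0" for a b c d
      using cyclic_pattern_imp_lattice[OF perm(4) orig 5, where a=a and b=d and c=b and d=c] that by (simp add: ac_simps)
    then show ?case
      by (intro that[of 1 4 2 3]) auto
  next
    case 6
    have "5 dvd a * 1 + b * 2 + c * 4 + d * 3" if "P a b c d" "a + b + c + d = 0" for a b c d
      using cyclic_pattern_imp_lattice[OF perm(5) orig 6, where a=a and b=d and c=c and d=b] that by (simp add: ac_simps)
    then show ?case
      by (intro that[of 1 2 4 3]) auto
  qed
qed

section \<open>Perfect codes of the square grid\<close>

definition square_code :: "(int \<Rightarrow> int \<Rightarrow> bool) \<Rightarrow> bool" where
  "square_code P \<longleftrightarrow> (\<forall>x y. of_bool (P x y) + of_bool (P (x + 1) y) + of_bool (P (x - 1) y)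
     + of_bool (P x (y + 1)) + of_bool (P x (y - 1)) = (1::nat))"

text \<open>The four knight moves of one chirality, an orbit under quarter turns. Transposing the
  code gives the other chirality.\<close>

definition knight_pattern :: "(int \<Rightarrow> int \<Rightarrow> bool) \<Rightarrow> int \<Rightarrow> int \<Rightarrow> bool" where
  "knight_pattern P x y \<longleftrightarrow>
     P x y \<and> P (x + 2) (y + 1) \<and> P (x + 1) (y - 2) \<and> P (x - 2) (y - 1) \<and> P (x - 1) (y + 2)"

lemma square_code_transpose:
  assumes "square_code P"
  shows "square_code (\<lambda>x y. P y x)"
  unfolding square_code_def
proof (intro allI, goal_cases)
  case (1 x y)
  then show ?case
    using assms[unfolded square_code_def, rule_format, of y x] by linarith
qed

text \<open>The closed neighbourhoods are plus-shaped tiles. A diagonal neighbour of the centre is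
  covered from one of two knight positions, and the choice at one corner forces the choice at the
  next, since tiles must not overlap. For the same reason the positions of the other chirality are
  then free of code points.\<close>

lemma square_code_local:
  assumes "square_code P" and "P x y"
  shows "knight_pattern P x y \<or> knight_pattern (\<lambda>x y. P y x) y x"
    and "\<not> (knight_pattern P x y \<and> P (x + 1) (y + 2))" "\<not> (knight_pattern P x y \<and> P (x - 1) (y - 2))"
    and "\<not> (knight_pattern P x y \<and> P (x + 2) (y - 1))" "\<not> (knight_pattern P x y \<and> P (x - 2) (y + 1))"
proof -
  note E = assms(1)[unfolded square_code_def of_bool_sum5_eq_1, rule_format]
  note facts = assms(2) E[of x y] E[of "x + 1" "y + 1", simplified] E[of "x - 1" "y + 1", simplified]
    E[of "x + 1" "y - 1", simplified] E[of "x - 1" "y - 1", simplified]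
    E[of "x + 1" y, simplified] E[of "x - 1" y, simplified] E[of x "y + 1", simplified] E[of x "y - 1", simplified]
    E[of "x + 2" y, simplified] E[of "x - 2" y, simplified] E[of x "y + 2", simplified] E[of x "y - 2", simplified]
  show "knight_pattern P x y \<or> knight_pattern (\<lambda>x y. P y x) y x"
    unfolding knight_pattern_def using facts by (smt (verit))
  show "\<not> (knight_pattern P x y \<and> P (x + 1) (y + 2))" "\<not> (knight_pattern P x y \<and> P (x - 1) (y - 2))"
    "\<not> (knight_pattern P x y \<and> P (x + 2) (y - 1))" "\<not> (knight_pattern P x y \<and> P (x - 2) (y + 1))"
    unfolding knight_pattern_def using facts by (smt (verit))+
qed

text \<open>The opposite chirality at the new point would forbid a code point at the old
  one.\<close>

lemma knight_pattern_step:
  assumes code: "square_code P" and "knight_pattern P x y"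
    and "(i, j) \<in> {(2, 1), (1, -2), (-2, -1), (-1, 2)}"
  shows "knight_pattern P (x + i) (y + j)"
proof -
  have P: "P x y" "P (x + i) (y + j)"
    using assms(2,3) unfolding knight_pattern_def by auto
  have "\<not> knight_pattern (\<lambda>x y. P y x) (y + j) (x + i)"
    using square_code_local(2-5)[OF square_code_transpose[OF code], where x = "y + j" and y = "x + i"] P assms(3)
    by auto
  then show ?thesis
    using square_code_local(1)[OF code P(2)] by blast
qed

text \<open>The moves (2, 1) and (-1, 2) have determinant 5, so they generate the whole index-5
  lattice.\<close>

lemma knight_pattern_lattice:
  assumes code: "square_code P" and orig: "knight_pattern P 0 0" and "5 dvd x - 2 * y"
  shows "knight_pattern P x y"
proof -
  let ?K = "knight_pattern P"
  note step = knight_pattern_step[OF code]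
  have 1: "?K (2 * i) i" for i
  proof (rule int_translation_closed[of "\<lambda>i. ?K (2 * i) i"])
    fix i assume "?K (2 * i) i"
    from step[OF this, of 2 1] step[OF this, of "-2" "-1"]
    show "?K (2 * (i + 1)) (i + 1)" "?K (2 * (i - 1)) (i - 1)"
      by (simp_all add: algebra_simps)
  qed (use orig in simp)
  have 2: "?K (2 * i - j) (i + 2 * j)" for i j
  proof (rule int_translation_closed[of "\<lambda>j. ?K (2 * i - j) (i + 2 * j)"])
    fix j assume "?K (2 * i - j) (i + 2 * j)"
    from step[OF this, of "-1" 2] step[OF this, of 1 "-2"]
    show "?K (2 * i - (j + 1)) (i + 2 * (j + 1))" "?K (2 * i - (j - 1)) (i + 2 * (j - 1))"
      by (simp_all add: algebra_simps)
  qed (use 1 in simp)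
  from assms(3) obtain e where "x = 2 * y + 5 * e"
    by (metis add.commute diff_add_cancel dvdE)
  then show ?thesis
    using 2[of "y + 2 * e" "- e"] by (simp add: algebra_simps)
qed

text \<open>The four neighbours change \<open>x - 2 * y\<close> by 1, -1, 2, -2, hence by every
  nonzero residue. A code point off the lattice would thus be adjacent to one on it.\<close>

lemma knight_pattern_imp_lattice:
  assumes code: "square_code P" and orig: "knight_pattern P 0 0" and P: "P x y"
  shows "5 dvd x - 2 * y"
proof (rule ccontr)
  assume nd: "\<not> ?thesis"
  have K: "P x y" if "5 dvd x - 2 * y" for x y
    using knight_pattern_lattice[OF code orig that] unfolding knight_pattern_def by blast
  have "\<not> P (x + 1) y" "\<not> P (x - 1) y" "\<not> P x (y + 1)" "\<not> P x (y - 1)"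
    using code[unfolded square_code_def of_bool_sum5_eq_1, rule_format, of x y] P by auto
  moreover have "5 dvd z \<or> 5 dvd z + 1 \<or> 5 dvd z - 1 \<or> 5 dvd z + 2 \<or> 5 dvd z - 2" for z :: int
    by presburger
  moreover have "x + 1 - 2 * y = (x - 2 * y) + 1" "x - 1 - 2 * y = (x - 2 * y) - 1"
    "x - 2 * (y + 1) = (x - 2 * y) - 2" "x - 2 * (y - 1) = (x - 2 * y) + 2"
    by simp_all
  ultimately show False
    using nd K[of "x + 1" y] K[of "x - 1" y] K[of x "y + 1"] K[of x "y - 1"] by metis
qed

lemma square_code_lattice:
  assumes code: "square_code P" and orig: "P 0 0"
  shows "(\<forall>x y. P x y \<longrightarrow> 5 dvd x - 2 * y) \<or> (\<forall>x y. P x y \<longrightarrow> 5 dvd x + 2 * y)"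
  using square_code_local(1)[OF assms]
proof
  assume "knight_pattern P 0 0"
  then show ?thesis
    using knight_pattern_imp_lattice[OF code] by blast
next
  assume K: "knight_pattern (\<lambda>x y. P y x) 0 0"
  have "5 dvd x + 2 * y" if "P x y" for x y
  proof -
    have "5 dvd y - 2 * x"
      using knight_pattern_imp_lattice[OF square_code_transpose[OF code] K that] .
    then show ?thesis by presburger
  qed
  then show ?thesis by blast
qed

section \<open>Nonexistence when a connecting involution is averaged out\<close>

text \<open>A parity argument on the three hexagons around the origin. Each neighbour of the origin
  has exactly one further code neighbour, which selects one of the two hexagons through it. The
  vertex of a hexagon opposite the origin is a code point exactly when the adjacent vertex on either
  side is not, so a hexagon is selected by both of its neighbours of the origin or by neither. But
  there are three selections.\<close>

lemma no_honeycomb_code_at_origin: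
  fixes P Q :: "int \<Rightarrow> int \<Rightarrow> bool"
  assumes 0: "\<And>i j. 2 * of_bool (P i j) + of_bool (Q i j) + of_bool (Q (i + 1) j) + of_bool (Q i (j + 1)) = (2::nat)"
    and 1: "\<And>i j. 2 * of_bool (Q i j) + of_bool (P i j) + of_bool (P (i - 1) j) + of_bool (P i (j - 1)) = (2::nat)"
  shows "\<not> P 0 0"
proof
  assume P: "P 0 0"
  have eq2: "2 * of_bool p + of_bool q + of_bool r + of_bool s = (2::nat) \<longleftrightarrow>
     (if p then \<not> q \<and> \<not> r \<and> \<not> s else (q \<or> r) \<and> (q \<or> s) \<and> (r \<or> s) \<and> \<not> (q \<and> r \<and> s))" for p q r s
    by (auto simp: of_bool_def)
  note E0 = 0[unfolded eq2] and E1 = 1[unfolded eq2]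
  show False
    using P E0[of 0 0, simplified] E1[of 0 0, simplified] E1[of 1 0, simplified] E1[of 0 1, simplified]
      E0[of 1 "-1", simplified] E0[of "-1" 1, simplified] E0[of 1 0, simplified] E0[of "-1" 0, simplified]
      E0[of 0 1, simplified] E0[of 0 "-1", simplified]
      E1[of 1 1, simplified] E1[of 1 "-1", simplified] E1[of "-1" 1, simplified]
    by (smt (verit))
qed

lemma no_honeycomb_code:
  fixes P Q :: "int \<Rightarrow> int \<Rightarrow> bool"
  assumes 0: "\<And>i j. 2 * of_bool (P i j) + of_bool (Q i j) + of_bool (Q (i + 1) j) + of_bool (Q i (j + 1)) = (2::nat)"
    and 1: "\<And>i j. 2 * of_bool (Q i j) + of_bool (P i j) + of_bool (P (i - 1) j) + of_bool (P i (j - 1)) = (2::nat)"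
  shows False
proof -
  have P: "\<not> P i j" for i j
  proof -
    have *: "x + 1 + y = x + y + 1" "x - 1 + y = x + y - 1" for x y :: int
      by simp_all
    have "\<not> (\<lambda>x y. P (x + i) (y + j)) 0 0"
      by (rule no_honeycomb_code_at_origin[where Q = "\<lambda>x y. Q (x + i) (y + j)"]) (simp_all only: * 0 1)
    then show ?thesis by simp
  qed
  have "Q i j" for i j
    using 1[of i j] P by (cases "Q i j") auto
  then show False
    using 0[of 0 0] P by simp
qed

text \<open>If \<open>p 0\<close> holds, then \<open>q 0\<close> is false and needs exactly one of
  \<open>q 1\<close> and \<open>q (-1)\<close>, say \<open>q 1\<close>. Then \<open>p 1\<close>
  already has two code neighbours, so \<open>p 2\<close> is false; but \<open>p 1\<close> and
  \<open>q 2\<close> are false too, which leaves \<open>p 2\<close> short of code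
  neighbours.\<close>

lemma no_ladder_code:
  fixes p q :: "int \<Rightarrow> bool"
  assumes 0: "\<And>i. 2 * of_bool (p i) + of_bool (p (i - 1)) + of_bool (p (i + 1)) + of_bool (q i) = (2::nat)"
    and 1: "\<And>i. 2 * of_bool (q i) + of_bool (q (i - 1)) + of_bool (q (i + 1)) + of_bool (p i) = (2::nat)"
  shows False
proof -
  have eq2: "2 * of_bool p + of_bool q + of_bool r + of_bool s = (2::nat) \<longleftrightarrow>
     (if p then \<not> q \<and> \<not> r \<and> \<not> s else (q \<or> r) \<and> (q \<or> s) \<and> (r \<or> s) \<and> \<not> (q \<and> r \<and> s))" for p q r s
    by (auto simp: of_bool_def)
  note E0 = 0[unfolded eq2] and E1 = 1[unfolded eq2]
  have "\<not> p i" for i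
    using E0[of i] E0[of "i + 1", simplified] E0[of "i - 1", simplified] E0[of "i + 2", simplified] E0[of "i - 2", simplified]
      E1[of i] E1[of "i + 1", simplified] E1[of "i - 1", simplified] E1[of "i + 2", simplified] E1[of "i - 2", simplified]
    by (smt (verit))
  then show False
    using 0[of 0] by (cases "q 0") auto
qed

text \<open>Summing over the index cube gives 4 N + N' = 8 = 4 N' + N, so both counts would be 8/5.
  Counting indices instead of group elements makes relations among the involutions harmless.\<close>

lemma no_code_three_involutions:
  fixes P Q :: "int \<Rightarrow> int \<Rightarrow> int \<Rightarrow> bool"
  assumes 0: "\<And>i j k. of_bool (P i j k) + of_bool (P (i + 1) j k) + of_bool (P i (j + 1) k) + of_bool (P i j (k + 1))
      + of_bool (Q i j k) = (1::nat)"
    and 1: "\<And>i j k. of_bool (Q i j k) + of_bool (Q (i + 1) j k) + of_bool (Q i (j + 1) k) + of_bool (Q i j (k + 1))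
      + of_bool (P i j k) = (1::nat)"
    and P: "\<And>i j k. P (i + 2) j k = P i j k" "\<And>i j k. P i (j + 2) k = P i j k" "\<And>i j k. P i j (k + 2) = P i j k"
    and Q: "\<And>i j k. Q (i + 2) j k = Q i j k" "\<And>i j k. Q i (j + 2) k = Q i j k" "\<And>i j k. Q i j (k + 2) = Q i j k"
  shows False
proof -
  define p q :: "int \<Rightarrow> int \<Rightarrow> int \<Rightarrow> nat"
    where "p = (\<lambda>i j k. of_bool (P i j k))" and "q = (\<lambda>i j k. of_bool (Q i j k))"
  have pq: "of_bool (P i j k) = p i j k" "of_bool (Q i j k) = q i j k" for i j k
    unfolding p_def q_def by simp_all
  have "p 2 j k = p 0 j k" "p i 2 k = p i 0 k" "p i j 2 = p i j 0"
    "q 2 j k = q 0 j k" "q i 2 k = q i 0 k" "q i j 2 = q i j 0" for i j k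
    using P(1)[of 0] P(2)[of _ 0] P(3)[of _ _ 0] Q(1)[of 0] Q(2)[of _ 0] Q(3)[of _ _ 0]
    unfolding p_def q_def by simp_all
  note s = pq add_0_left one_add_one this
  define N :: "(int \<Rightarrow> int \<Rightarrow> int \<Rightarrow> nat) \<Rightarrow> nat"
    where "N = (\<lambda>p. p 0 0 0 + p 0 0 1 + p 0 1 0 + p 0 1 1 + p 1 0 0 + p 1 0 1 + p 1 1 0 + p 1 1 1)"
  have "4 * N p + N q = (p 0 0 0 + p 1 0 0 + p 0 1 0 + p 0 0 1 + q 0 0 0)
      + (p 0 0 1 + p 1 0 1 + p 0 1 1 + p 0 0 0 + q 0 0 1)
      + (p 0 1 0 + p 1 1 0 + p 0 0 0 + p 0 1 1 + q 0 1 0)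
      + (p 0 1 1 + p 1 1 1 + p 0 0 1 + p 0 1 0 + q 0 1 1)
      + (p 1 0 0 + p 0 0 0 + p 1 1 0 + p 1 0 1 + q 1 0 0)
      + (p 1 0 1 + p 0 0 1 + p 1 1 1 + p 1 0 0 + q 1 0 1)
      + (p 1 1 0 + p 0 1 0 + p 1 0 0 + p 1 1 1 + q 1 1 0)
      + (p 1 1 1 + p 0 1 1 + p 1 0 1 + p 1 1 0 + q 1 1 1)"
    unfolding N_def by simp
  then have "4 * N p + N q = 8"
    unfolding 0[of 0 0 0, unfolded s] 0[of 0 0 1, unfolded s]
      0[of 0 1 0, unfolded s] 0[of 0 1 1, unfolded s]
      0[of 1 0 0, unfolded s] 0[of 1 0 1, unfolded s]
      0[of 1 1 0, unfolded s] 0[of 1 1 1, unfolded s] by simp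
  moreover have "4 * N q + N p = (q 0 0 0 + q 1 0 0 + q 0 1 0 + q 0 0 1 + p 0 0 0)
      + (q 0 0 1 + q 1 0 1 + q 0 1 1 + q 0 0 0 + p 0 0 1)
      + (q 0 1 0 + q 1 1 0 + q 0 0 0 + q 0 1 1 + p 0 1 0)
      + (q 0 1 1 + q 1 1 1 + q 0 0 1 + q 0 1 0 + p 0 1 1)
      + (q 1 0 0 + q 0 0 0 + q 1 1 0 + q 1 0 1 + p 1 0 0)
      + (q 1 0 1 + q 0 0 1 + q 1 1 1 + q 1 0 0 + p 1 0 1)
      + (q 1 1 0 + q 0 1 0 + q 1 0 0 + q 1 1 1 + p 1 1 0)
      + (q 1 1 1 + q 0 1 1 + q 1 0 1 + q 1 1 0 + p 1 1 1)"
    unfolding N_def by simp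
  then have "4 * N q + N p = 8"
    unfolding 1[of 0 0 0, unfolded s] 1[of 0 0 1, unfolded s]
      1[of 0 1 0, unfolded s] 1[of 0 1 1, unfolded s]
      1[of 1 0 0, unfolded s] 1[of 1 0 1, unfolded s]
      1[of 1 1 0, unfolded s] 1[of 1 1 1, unfolded s] by simp
  moreover have False if "4 * x + y = 8" "4 * y + x = 8" for x y :: nat
    using that by presburger
  ultimately show False
    by blast
qed

text \<open>Each layer is summed over its index square. A layer count is at most 1 because three
  times it is at most 4; it cannot be 0, since two other counts would have to add up to 4. All
  counts are then 1, and the total is 5 instead of 4.\<close>

lemma no_code_two_involutions:
  fixes P Q :: "int \<Rightarrow> int \<Rightarrow> int \<Rightarrow> bool"
  assumes 0: "\<And>i j k. of_bool (P i j k) + of_bool (P (i + 1) j k) + of_bool (P i (j + 1) k)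
      + of_bool (Q i j k) + of_bool (Q i j (k + 1)) = (1::nat)"
    and 1: "\<And>i j k. of_bool (Q i j k) + of_bool (Q (i + 1) j k) + of_bool (Q i (j + 1) k)
      + of_bool (P i j k) + of_bool (P i j (k - 1)) = (1::nat)"
    and P: "\<And>i j k. P (i + 2) j k = P i j k" "\<And>i j k. P i (j + 2) k = P i j k"
    and Q: "\<And>i j k. Q (i + 2) j k = Q i j k" "\<And>i j k. Q i (j + 2) k = Q i j k"
  shows False
proof -
  define p q :: "int \<Rightarrow> int \<Rightarrow> int \<Rightarrow> nat"
    where "p = (\<lambda>i j k. of_bool (P i j k))" and "q = (\<lambda>i j k. of_bool (Q i j k))"
  have pq: "of_bool (P i j k) = p i j k" "of_bool (Q i j k) = q i j k" for i j k
    unfolding p_def q_def by simp_all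
  have "p 2 j k = p 0 j k" "p i 2 k = p i 0 k" "q 2 j k = q 0 j k" "q i 2 k = q i 0 k" for i j k
    using P(1)[of 0] P(2)[of _ 0] Q(1)[of 0] Q(2)[of _ 0] unfolding p_def q_def by simp_all
  note s = pq add_0_left one_add_one this
  define N :: "(int \<Rightarrow> int \<Rightarrow> int \<Rightarrow> nat) \<Rightarrow> int \<Rightarrow> nat"
    where "N = (\<lambda>p k. p 0 0 k + p 0 1 k + p 1 0 k + p 1 1 k)"
  have a: "3 * N p k + N q k + N q (k + 1) = 4" for k
  proof -
    have "3 * N p k + N q k + N q (k + 1) = (p 0 0 k + p 1 0 k + p 0 1 k + q 0 0 k + q 0 0 (k + 1))
      + (p 0 1 k + p 1 1 k + p 0 0 k + q 0 1 k + q 0 1 (k + 1))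
      + (p 1 0 k + p 0 0 k + p 1 1 k + q 1 0 k + q 1 0 (k + 1))
      + (p 1 1 k + p 0 1 k + p 1 0 k + q 1 1 k + q 1 1 (k + 1))"
      unfolding N_def by simp
    then show ?thesis
      unfolding 0[of 0 0 k, unfolded s] 0[of 0 1 k, unfolded s] 0[of 1 0 k, unfolded s] 0[of 1 1 k, unfolded s] by simp
  qed
  have b: "3 * N q k + N p k + N p (k - 1) = 4" for k
  proof -
    have "3 * N q k + N p k + N p (k - 1) = (q 0 0 k + q 1 0 k + q 0 1 k + p 0 0 k + p 0 0 (k - 1))
      + (q 0 1 k + q 1 1 k + q 0 0 k + p 0 1 k + p 0 1 (k - 1))
      + (q 1 0 k + q 0 0 k + q 1 1 k + p 1 0 k + p 1 0 (k - 1))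
      + (q 1 1 k + q 0 1 k + q 1 0 k + p 1 1 k + p 1 1 (k - 1))"
      unfolding N_def by simp
    then show ?thesis
      unfolding 1[of 0 0 k, unfolded s] 1[of 0 1 k, unfolded s] 1[of 1 0 k, unfolded s] 1[of 1 1 k, unfolded s] by simp
  qed
  have le: "N p k \<le> 1" "N q k \<le> 1" for k
    using a[of k] b[of k] by linarith+
  have "N p k = 1" "N q k = 1" for k
    using a[of k] b[of k] le[of k] le[of "k + 1"] le[of "k - 1"] by linarith+
  with a[of 0] show False by simp
qed

section \<open>Arithmetic of residues modulo 5\<close>

lemma residue_count_quadruple:
  fixes a b r :: int
  assumes "a \<in> {1, 2, 3}" "b \<in> {1, 2, 3}" "a \<noteq> b" "r \<in> {0, 1, 2, 3, 4}"
  shows "of_bool (r = 0) + of_bool (r = (a + b - 1) mod 5) + of_bool ((r + 1) mod 5 = (a + b - 1) mod 5)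
      + of_bool ((r - a) mod 5 = (a + b - 1) mod 5) + of_bool ((r - b) mod 5 = (a + b - 1) mod 5) = (1::nat)"
    and "of_bool (r = (a + b - 1) mod 5) + of_bool (r = 0) + of_bool ((r - 1) mod 5 = 0)
      + of_bool ((r + a) mod 5 = 0) + of_bool ((r + b) mod 5 = 0) = (1::nat)"
proof -
  have "a = 1 \<and> b = 2 \<or> a = 1 \<and> b = 3 \<or> a = 2 \<and> b = 1 \<or> a = 2 \<and> b = 3 \<or> a = 3 \<and> b = 1 \<or> a = 3 \<and> b = 2"
    "r = 0 \<or> r = 1 \<or> r = 2 \<or> r = 3 \<or> r = 4"
    using assms by auto
  then show "of_bool (r = 0) + of_bool (r = (a + b - 1) mod 5) + of_bool ((r + 1) mod 5 = (a + b - 1) mod 5)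
      + of_bool ((r - a) mod 5 = (a + b - 1) mod 5) + of_bool ((r - b) mod 5 = (a + b - 1) mod 5) = (1::nat)"
    "of_bool (r = (a + b - 1) mod 5) + of_bool (r = 0) + of_bool ((r - 1) mod 5 = 0)
      + of_bool ((r + a) mod 5 = 0) + of_bool ((r + b) mod 5 = 0) = (1::nat)"
    by (elim disjE conjE; hypsubst; simp)+
qed

text \<open>The values of \<open>r\<close> counted are 0, -w, w, 3, 2 in the first sum and 3, 3 - w,
  3 + w, 0, 1 in the second; each list is a complete residue system.\<close>

lemma residue_count_cyclic_pair:
  fixes w r :: int
  assumes "w \<in> {1, - 1}" "r \<in> {0, 1, 2, 3, 4}"
  shows "of_bool (r = 0) + of_bool ((r + w) mod 5 = 0) + of_bool ((r - w) mod 5 = 0) + of_bool (r = 3)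
      + of_bool ((r + 1) mod 5 = 3) = (1::nat)"
    and "of_bool (r = 3) + of_bool ((r + w) mod 5 = 3) + of_bool ((r - w) mod 5 = 3) + of_bool (r = 0)
      + of_bool ((r - 1) mod 5 = 0) = (1::nat)"
proof -
  have "w = 1 \<or> w = - 1" "r = 0 \<or> r = 1 \<or> r = 2 \<or> r = 3 \<or> r = 4"
    using assms by auto
  then show "of_bool (r = 0) + of_bool ((r + w) mod 5 = 0) + of_bool ((r - w) mod 5 = 0) + of_bool (r = 3)
      + of_bool ((r + 1) mod 5 = 3) = (1::nat)"
    "of_bool (r = 3) + of_bool ((r + w) mod 5 = 3) + of_bool ((r - w) mod 5 = 3) + of_bool (r = 0)
      + of_bool ((r - 1) mod 5 = 0) = (1::nat)"
    by (elim disjE conjE; hypsubst; simp)+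
qed

lemma residue_five: "(c::int) mod 5 \<in> {0, 1, 2, 3, 4}"
proof -
  have "c mod 5 = 0 \<or> c mod 5 = 1 \<or> c mod 5 = 2 \<or> c mod 5 = 3 \<or> c mod 5 = 4"
    by presburger
  then show ?thesis by blast
qed

text \<open>The affine map taking \<open>x\<close> to 0 and \<open>y\<close> to 1 modulo 5 takes
  \<open>z\<close> to 2, 3 or 4, and the sign turns this into 3, 2 or 1.\<close>

lemma distinct_residues_five:
  fixes x y z :: int
  assumes "x \<in> {1, 2, 3, 4}" "y \<in> {1, 2, 3, 4}" "z \<in> {1, 2, 3, 4}" "x \<noteq> y" "x \<noteq> z" "y \<noteq> z"
  shows "(- ((y - x) ^ 3) * (z - x)) mod 5 \<in> {1, 2, 3}" and "5 dvd (y - x) ^ 3 * (y - x) - 1"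
proof -
  have "(x = 1 \<or> x = 2 \<or> x = 3 \<or> x = 4) \<and> (y = 1 \<or> y = 2 \<or> y = 3 \<or> y = 4) \<and> (z = 1 \<or> z = 2 \<or> z = 3 \<or> z = 4)"
    using assms by simp
  then have "((- ((y - x) ^ 3) * (z - x)) mod 5 = 1 \<or> (- ((y - x) ^ 3) * (z - x)) mod 5 = 2
      \<or> (- ((y - x) ^ 3) * (z - x)) mod 5 = 3) \<and> ((y - x) ^ 3 * (y - x) - 1) mod 5 = 0"
    using assms(4-6) by (elim disjE conjE; hypsubst; simp)
  then show "(- ((y - x) ^ 3) * (z - x)) mod 5 \<in> {1, 2, 3}" "5 dvd (y - x) ^ 3 * (y - x) - 1"
    by (simp_all add: dvd_eq_mod_eq_0)
qed

section \<open>Codes of Cayley graphs of generalized dihedral groups\<close>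

context group
begin

lemma cayley_graph_dominates_iff:
  "x \<rightarrow>\<^bsub>cayley_graph G S\<^esub> y \<longleftrightarrow> x \<in> carrier G \<and> y \<in> carrier G \<and> y \<otimes> inv x \<in> S"
  unfolding cayley_graph_def by (auto simp: arcs_ends_conv)

lemma verts_cayley_graph: "verts (cayley_graph G S) = carrier G"
  unfolding cayley_graph_def by simp

text \<open>Connectedness refers to the symmetric closure. As \<open>S\<close> is inverse-closed, a
  reversed arc is again a left multiplication by an element of \<open>S\<close>.\<close>

lemma cayley_graph_connected_induct:
  assumes "Digraph_Component.connected (cayley_graph G S)"
    and S: "S \<subseteq> carrier G" "\<And>s. s \<in> S \<Longrightarrow> inv s \<in> S"
    and "P \<one>" and step: "\<And>s x. s \<in> S \<Longrightarrow> x \<in> carrier G \<Longrightarrow> P x \<Longrightarrow> P (s \<otimes> x)"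
    and x: "x \<in> carrier G"
  shows "P x"
proof -
  let ?H = "mk_symmetric (cayley_graph G S)"
  have arc: "(u, v) \<in> arcs_ends ?H \<Longrightarrow> u \<in> carrier G \<and> (\<exists>s\<in>S. v = s \<otimes> u)" for u v
  proof -
    assume "(u, v) \<in> arcs_ends ?H"
    then have "u \<rightarrow>\<^bsub>cayley_graph G S\<^esub> v \<or> v \<rightarrow>\<^bsub>cayley_graph G S\<^esub> u"
      by (auto simp: parcs_mk_symmetric arcs_ends_conv)
    then have uv: "u \<in> carrier G" "v \<in> carrier G" "v \<otimes> inv u \<in> S \<or> u \<otimes> inv v \<in> S"
      unfolding cayley_graph_dominates_iff by auto
    then have "v \<otimes> inv u \<in> S"
      using S(2)[of "u \<otimes> inv v"] by (auto simp: inv_mult_group)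
    then show ?thesis
      using uv by (intro conjI bexI[of _ "v \<otimes> inv u"]) (simp_all add: m_assoc)
  qed
  have "\<one> \<rightarrow>\<^sup>*\<^bsub>?H\<^esub> x"
    using assms(1) x unfolding connected_def strongly_connected_def by (simp add: verts_cayley_graph)
  then show ?thesis
    unfolding reachable_def
    by (induction rule: rtrancl_on_induct) (use arc step \<open>P \<one>\<close> in auto)
qed

text \<open>The dominators of \<open>v\<close> are the products \<open>s v\<close>, distinct for
  distinct \<open>s\<close>. A sum over the natural numbers, unlike unique existence, can be added
  up over several vertices.\<close>

lemma perfect_code_cayley_graph_iff:
  assumes S: "S \<subseteq> carrier G - {\<one>}" "\<And>s. s \<in> S \<Longrightarrow> inv s \<in> S" and "finite S"
  shows "perfect_code (cayley_graph G S) D \<longleftrightarrow>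
    D \<subseteq> carrier G \<and> (\<forall>v\<in>carrier G. (\<Sum>s\<in>insert \<one> S. of_bool (s \<otimes> v \<in> D)) = (1::nat))"
proof -
  have "(\<exists>!u. u \<in> D \<and> vertex_dominates (cayley_graph G S) u v) \<longleftrightarrow>
      (\<Sum>s\<in>insert \<one> S. of_bool (s \<otimes> v \<in> D)) = (1::nat)"
    if D: "D \<subseteq> carrier G" and v: "v \<in> carrier G" for v
  proof -
    let ?T = "insert \<one> S \<inter> {s. s \<otimes> v \<in> D}"
    have dom: "vertex_dominates (cayley_graph G S) u v \<longleftrightarrow> (\<exists>s\<in>insert \<one> S. u = s \<otimes> v)"
      if u: "u \<in> carrier G" for u
    proof
      assume "vertex_dominates (cayley_graph G S) u v"
      then have "u = v \<or> v \<otimes> inv u \<in> S"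
        unfolding vertex_dominates_def cayley_graph_dominates_iff by auto
      then show "\<exists>s\<in>insert \<one> S. u = s \<otimes> v"
      proof
        assume "v \<otimes> inv u \<in> S"
        from S(2)[OF this] have "u \<otimes> inv v \<in> S"
          using u v by (simp add: inv_mult_group)
        then show ?thesis
          using u v by (intro bexI[of _ "u \<otimes> inv v"]) (simp_all add: m_assoc)
      qed (use v in simp)
    next
      assume "\<exists>s\<in>insert \<one> S. u = s \<otimes> v"
      then obtain s where s: "s \<in> insert \<one> S" "u = s \<otimes> v"
        by blast
      have "v \<otimes> inv u = inv s" if "s \<in> S"
        using that S v unfolding s(2) by (subst inv_mult_group) (auto simp: m_assoc[symmetric])
      then show "vertex_dominates (cayley_graph G S) u v"
        using s u v S(2) unfolding vertex_dominates_def cayley_graph_dominates_iff by auto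
    qed
    have "{u. u \<in> D \<and> vertex_dominates (cayley_graph G S) u v} = (\<lambda>s. s \<otimes> v) ` ?T"
      using D dom by auto
    moreover have "inj_on (\<lambda>s. s \<otimes> v) ?T"
      using S(1) v by (intro inj_onI) (auto simp: subset_iff)
    ultimately have "card {u. u \<in> D \<and> vertex_dominates (cayley_graph G S) u v} = card ?T"
      by (simp add: card_image)
    moreover have "(\<Sum>s\<in>insert \<one> S. of_bool (s \<otimes> v \<in> D)) = card ?T"
      using \<open>finite S\<close> by (subst sum_of_bool_eq) auto
    moreover have "(\<exists>!u. Q u) \<longleftrightarrow> card {u. Q u} = 1" for Q :: "'a \<Rightarrow> bool"
      unfolding One_nat_def card_1_singleton_iff by (auto simp: set_eq_iff)
    ultimately show ?thesis
      by simp
  qed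
  then show ?thesis
    unfolding perfect_code_def verts_cayley_graph by blast
qed

end

context generalized_dihedral
begin

lemma A_carrier [simp]: "a \<in> A \<Longrightarrow> a \<in> carrier G"
  using subgroup.mem_carrier[OF A_subgroup] .

lemma A_closed [simp]:
  "\<one> \<in> A" "a \<in> A \<Longrightarrow> b \<in> A \<Longrightarrow> a \<otimes> b \<in> A" "a \<in> A \<Longrightarrow> inv a \<in> A"
  using A_subgroup by (simp_all add: subgroup.one_closed subgroup.m_closed subgroup.m_inv_closed)

lemma A_int_pow [simp]: "a \<in> A \<Longrightarrow> a [^] (k::int) \<in> A"
  by (rule subgroup_int_pow_closed[OF A_subgroup])

lemma A_commute: "a \<in> A \<Longrightarrow> b \<in> A \<Longrightarrow> a \<otimes> b = b \<otimes> a"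
  using comm_groupE(4)[OF A_comm] by simp

lemma A_left_commute: "a \<in> A \<Longrightarrow> b \<in> A \<Longrightarrow> c \<in> A \<Longrightarrow> a \<otimes> (b \<otimes> c) = b \<otimes> (a \<otimes> c)"
  using A_commute[of a b] m_assoc[of a b c] m_assoc[of b a c] by simp

lemmas A_ac = m_assoc A_commute A_left_commute

lemma t_carrier [simp]: "t \<in> carrier G" and t_notin: "t \<notin> A"
  using t_outside by auto

lemma t_mult_notin: "a \<in> A \<Longrightarrow> t \<otimes> a \<notin> A"
proof
  assume a: "a \<in> A" "t \<otimes> a \<in> A"
  then have "t \<otimes> a \<otimes> inv a \<in> A" by simp
  with a t_notin show False by (simp add: m_assoc)
qed

lemma t_cancel [simp]: "x \<in> carrier G \<Longrightarrow> t \<otimes> (t \<otimes> x) = x"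
  using t_involution(2) by (simp add: m_assoc[symmetric])

lemma A_mult_t: "a \<in> A \<Longrightarrow> a \<otimes> t = t \<otimes> inv a"
  using t_inverts[of "a"] t_cancel[of "a \<otimes> t"] by (simp add: m_assoc)

lemma carrier_cases:
  assumes "x \<in> carrier G"
  obtains "x \<in> A" | a where "a \<in> A" "x = t \<otimes> a"
proof (cases "x \<in> A")
  case False
  have cos: "A #> y \<in> rcosets A" "y \<in> A #> y" if "y \<in> carrier G" for y
    using that rcosetsI[of A y] rcos_self[OF that A_subgroup] by (auto simp: subset_iff)
  have "A = A #> \<one>"
    by (simp add: subset_iff)
  then have A: "A \<in> rcosets A"
    using cos(1)[of \<one>] by simp
  have "A #> x \<noteq> A" "A #> t \<noteq> A"
    using False t_notin cos(2)[OF assms] cos(2)[of t] by auto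
  then have "A #> x = A #> t"
    using A cos(1)[OF assms] cos(1)[of t] A_index unfolding card_2_iff by auto
  then obtain a where a: "a \<in> A" "x = a \<otimes> t"
    using cos(2)[OF assms] unfolding r_coset_def by auto
  then show thesis
    using that(2)[of "inv a"] by (simp add: A_mult_t)
qed

text \<open>
  Here \<open>B = S \<inter> A\<close> and \<open>t C = S - A\<close>; the code is \<open>D \<union> t E\<close>.
\<close>

definition code_system :: "'a set \<Rightarrow> 'a set \<Rightarrow> 'a set \<Rightarrow> 'a set \<Rightarrow> bool" where
  "code_system B C D E \<longleftrightarrow> (\<forall>x\<in>A.
     (\<Sum>b\<in>insert \<one> B. of_bool (x \<otimes> b \<in> D)) + (\<Sum>c\<in>C. of_bool (x \<otimes> c \<in> E)) = (1::nat) \<and>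
     (\<Sum>b\<in>insert \<one> B. of_bool (x \<otimes> b \<in> E)) + (\<Sum>c\<in>C. of_bool (x \<otimes> inv c \<in> D)) = (1::nat))"

text \<open>At a vertex \<open>t x\<close>, \<open>b (t x) = t (x b^-1)\<close> and
  \<open>(t c) (t x) = c^-1 x\<close>. The inverse on \<open>b\<close> is absorbed because
  \<open>S\<close> is inverse-closed; the one on \<open>c\<close> stays and makes the two equations
  differ.\<close>

lemma perfect_code_iff_code_system:
  assumes S: "S \<subseteq> carrier G - {\<one>}" "\<And>s. s \<in> S \<Longrightarrow> inv s \<in> S" and D: "D \<subseteq> carrier G"
  shows "perfect_code (cayley_graph G S) D \<longleftrightarrow>
    code_system (S \<inter> A) {c \<in> A. t \<otimes> c \<in> S} (D \<inter> A) {a \<in> A. t \<otimes> a \<in> D}"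
proof -
  let ?B = "insert \<one> (S \<inter> A)" and ?X = "{c \<in> A. t \<otimes> c \<in> S}" and ?E = "{a \<in> A. t \<otimes> a \<in> D}"
  have fin: "finite S"
    using S(1) finite_carrier by (meson Diff_subset finite_subset)
  have finX: "finite ?X"
    using finite_carrier by (rule finite_subset[rotated]) auto
  have T: "insert \<one> S = ?B \<union> (\<otimes>) t ` ?X"
  proof (intro equalityI subsetI)
    fix s assume "s \<in> insert \<one> S"
    moreover have "s \<in> ?B \<union> (\<otimes>) t ` ?X" if "s \<in> S"
      by (rule carrier_cases[of s]) (use that S(1) in auto)
    ultimately show "s \<in> ?B \<union> (\<otimes>) t ` ?X" by auto
  qed auto
  have disj: "?B \<inter> (\<otimes>) t ` ?X = {}"
  proof -
    have "?B \<subseteq> A" by auto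
    moreover have "(\<otimes>) t ` ?X \<inter> A = {}"
      using t_mult_notin by auto
    ultimately show ?thesis by blast
  qed
  have inj: "inj_on ((\<otimes>) t) ?X"
    by (intro inj_onI) auto
  have split: "(\<Sum>s\<in>insert \<one> S. f s) = (\<Sum>b\<in>?B. f b) + (\<Sum>c\<in>?X. f (t \<otimes> c))" for f :: "'a \<Rightarrow> nat"
    unfolding T using fin finX disj by (subst sum.union_disjoint) (auto simp: sum.reindex[OF inj])
  have 0: "(\<Sum>s\<in>insert \<one> S. of_bool (s \<otimes> x \<in> D)) =
      (\<Sum>b\<in>?B. of_bool (x \<otimes> b \<in> D \<inter> A)) + (\<Sum>c\<in>?X. of_bool (x \<otimes> c \<in> ?E) :: nat)" if x: "x \<in> A" for x
    unfolding split using x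
    by (intro arg_cong2[where f = "(+)"] sum.cong refl) (auto simp: A_commute[OF x] m_assoc)
  have 1: "(\<Sum>s\<in>insert \<one> S. of_bool (s \<otimes> (t \<otimes> x) \<in> D)) =
      (\<Sum>b\<in>?B. of_bool (x \<otimes> b \<in> ?E)) + (\<Sum>c\<in>?X. of_bool (x \<otimes> inv c \<in> D \<inter> A) :: nat)" if x: "x \<in> A" for x
  proof -
    have tb: "b \<otimes> (t \<otimes> x) = t \<otimes> (x \<otimes> inv b)" if "b \<in> A" for b
      using that x by (simp add: m_assoc[symmetric] A_mult_t) (simp add: m_assoc A_commute)
    have "(\<Sum>b\<in>?B. of_bool (b \<otimes> (t \<otimes> x) \<in> D)) = (\<Sum>b\<in>?B. of_bool (x \<otimes> inv b \<in> ?E) :: nat)"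
      using x tb by (intro sum.cong refl) auto
    also have "\<dots> = (\<Sum>b\<in>?B. of_bool (x \<otimes> b \<in> ?E))"
      by (rule sum.reindex_bij_witness[of _ "m_inv G" "m_inv G"]) (use S in auto)
    finally have "(\<Sum>b\<in>?B. of_bool (b \<otimes> (t \<otimes> x) \<in> D)) = (\<Sum>b\<in>?B. of_bool (x \<otimes> b \<in> ?E) :: nat)" .
    moreover have "(\<Sum>c\<in>?X. of_bool (t \<otimes> c \<otimes> (t \<otimes> x) \<in> D)) = (\<Sum>c\<in>?X. of_bool (x \<otimes> inv c \<in> D \<inter> A) :: nat)"
      using x tb by (intro sum.cong refl) (auto simp: m_assoc)
    ultimately show ?thesis
      unfolding split by simp
  qed
  have all: "(\<forall>v\<in>carrier G. P v) \<longleftrightarrow> (\<forall>x\<in>A. P x \<and> P (t \<otimes> x))" for P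
  proof
    assume *: "\<forall>x\<in>A. P x \<and> P (t \<otimes> x)"
    show "\<forall>v\<in>carrier G. P v"
    proof
      fix v assume "v \<in> carrier G"
      then show "P v"
        by (rule carrier_cases) (use * in auto)
    qed
  qed auto
  have "perfect_code (cayley_graph G S) D \<longleftrightarrow>
      (\<forall>v\<in>carrier G. (\<Sum>s\<in>insert \<one> S. of_bool (s \<otimes> v \<in> D)) = (1::nat))"
    using perfect_code_cayley_graph_iff[OF S fin, of D] D by (simp only: simp_thms)
  also have "\<dots> \<longleftrightarrow> code_system (S \<inter> A) ?X (D \<inter> A) ?E"
    unfolding code_system_def all by (intro ball_cong refl) (simp only: 0 1)
  finally show ?thesis .
qed

lemma ex_perfect_code_iff:
  assumes S: "S \<subseteq> carrier G - {\<one>}" "\<And>s. s \<in> S \<Longrightarrow> inv s \<in> S"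
  shows "(\<exists>D. perfect_code (cayley_graph G S) D) \<longleftrightarrow>
    (\<exists>D E. D \<subseteq> A \<and> E \<subseteq> A \<and> code_system (S \<inter> A) {c \<in> A. t \<otimes> c \<in> S} D E)"
proof
  assume "\<exists>D. perfect_code (cayley_graph G S) D"
  then obtain D where D: "perfect_code (cayley_graph G S) D"
    by blast
  then have "D \<subseteq> carrier G"
    unfolding perfect_code_def verts_cayley_graph by blast
  from perfect_code_iff_code_system[OF S this] D
  show "\<exists>D E. D \<subseteq> A \<and> E \<subseteq> A \<and> code_system (S \<inter> A) {c \<in> A. t \<otimes> c \<in> S} D E"
    by (intro exI[of _ "D \<inter> A"] exI[of _ "{a \<in> A. t \<otimes> a \<in> D}"]) simp
next
  assume "\<exists>D E. D \<subseteq> A \<and> E \<subseteq> A \<and> code_system (S \<inter> A) {c \<in> A. t \<otimes> c \<in> S} D E"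
  then obtain D E where DE: "D \<subseteq> A" "E \<subseteq> A" "code_system (S \<inter> A) {c \<in> A. t \<otimes> c \<in> S} D E"
    by blast
  let ?F = "D \<union> (\<otimes>) t ` E"
  have "?F \<inter> A = D"
    using DE t_mult_notin by auto
  moreover have "{a \<in> A. t \<otimes> a \<in> ?F} = E"
    using DE t_mult_notin by (auto simp: subset_iff)
  moreover have "?F \<subseteq> carrier G"
    using DE by (auto simp: subset_iff)
  ultimately show "\<exists>D. perfect_code (cayley_graph G S) D"
    using perfect_code_iff_code_system[OF S, of ?F] DE(3) by auto
qed

end

section \<open>Homomorphisms onto the integers modulo 5\<close>

context group
begin

text \<open>The exponents that take \<open>s\<close> into \<open>H\<close> form an ideal of the
  integers, generated by its least positive element.\<close>

lemma least_exponent_into: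
  assumes H: "subgroup H G" and "finite (carrier G)" and s: "s \<in> carrier G"
  defines "m \<equiv> least_exponent_into G s H"
  shows "0 < m" and "s [^] m \<in> H" and "s [^] (z::int) \<in> H \<longleftrightarrow> int m dvd z"
proof -
  have "0 < ord s \<and> s [^] ord s \<in> H"
    using ord_ge_1[OF assms(2) s] s subgroup.one_closed[OF H] by simp
  then have m: "0 < m \<and> s [^] m \<in> H"
    unfolding m_def least_exponent_into_def by (rule LeastI)
  then show "0 < m" "s [^] m \<in> H" by auto
  have mult: "s [^] (int m * q) \<in> H" for q :: int
    using subgroup_int_pow_closed[OF H, of "s [^] m" q] m s by (simp add: int_pow_pow flip: int_pow_int)
  show "s [^] z \<in> H \<longleftrightarrow> int m dvd z"
  proof
    assume z: "s [^] z \<in> H"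
    define r where "r = nat (z mod int m)"
    have r: "int r = z mod int m" "r < m"
      using m unfolding r_def by (auto simp: nat_less_iff)
    have "s [^] r = s [^] z \<otimes> inv (s [^] (int m * (z div int m)))"
      using s r(1) by (simp add: minus_mult_div_eq_mod flip: int_pow_int int_pow_diff)
    then have "s [^] r \<in> H"
      using z mult[of "z div int m"] H by (simp add: subgroup.m_closed subgroup.m_inv_closed)
    then have "\<not> 0 < r"
      using not_less_Least[of r "\<lambda>k. 0 < k \<and> s [^] k \<in> H"] r(2)
      unfolding m_def least_exponent_into_def by auto
    with r(1) show "int m dvd z"
      by (simp add: dvd_eq_mod_eq_0)
  qed (auto simp: mult elim!: dvdE)
qed

end

context generalized_dihedral
begin

definition power_word :: "'a \<Rightarrow> 'a \<Rightarrow> 'a \<Rightarrow> int \<Rightarrow> int \<Rightarrow> int \<Rightarrow> 'a" where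
  "power_word s0 s1 s2 i j k = s0 [^] i \<otimes> s1 [^] j \<otimes> s2 [^] k"

lemma power_word_closed [simp]:
  "s0 \<in> A \<Longrightarrow> s1 \<in> A \<Longrightarrow> s2 \<in> A \<Longrightarrow> power_word s0 s1 s2 i j k \<in> A"
  unfolding power_word_def by simp

lemma power_word_0 [simp]: "power_word s0 s1 s2 0 0 0 = \<one>"
  unfolding power_word_def by simp

lemma power_word_mult:
  assumes "s0 \<in> A" "s1 \<in> A" "s2 \<in> A"
  shows "power_word s0 s1 s2 i j k \<otimes> power_word s0 s1 s2 i' j' k' = power_word s0 s1 s2 (i + i') (j + j') (k + k')"
  using assms unfolding power_word_def by (simp add: int_pow_mult A_ac)

lemma power_word_inv:
  assumes "s0 \<in> A" "s1 \<in> A" "s2 \<in> A"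
  shows "inv (power_word s0 s1 s2 i j k) = power_word s0 s1 s2 (- i) (- j) (- k)"
  by (rule inv_equality) (use assms in \<open>simp_all add: power_word_mult\<close>)

lemma power_word_eq_iff:
  assumes "s0 \<in> A" "s1 \<in> A" "s2 \<in> A"
  shows "power_word s0 s1 s2 i j k = power_word s0 s1 s2 i' j' k' \<longleftrightarrow>
    power_word s0 s1 s2 (i - i') (j - j') (k - k') = \<one>"
proof -
  have "power_word s0 s1 s2 i j k = power_word s0 s1 s2 (i - i') (j - j') (k - k') \<otimes> power_word s0 s1 s2 i' j' k'"
    using assms by (simp add: power_word_mult)
  then show ?thesis
    using assms by (simp add: r_cancel_one')
qed

lemma power_word_generators:
  assumes "s0 \<in> A" "s1 \<in> A" "s2 \<in> A"
  shows "power_word s0 s1 s2 1 0 0 = s0" "power_word s0 s1 s2 0 1 0 = s1" "power_word s0 s1 s2 0 0 1 = s2"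
  using assms unfolding power_word_def by simp_all

lemma power_word_int_pow:
  assumes "s0 \<in> A" "s1 \<in> A" "s2 \<in> A"
  shows "power_word s0 s1 s2 i j k [^] (z::int) = power_word s0 s1 s2 (i * z) (j * z) (k * z)"
  using assms unfolding power_word_def
  by (simp add: int_pow_mult_distrib int_pow_pow A_commute)

lemma generate_pair:
  assumes "s0 \<in> A" "s1 \<in> A"
  shows "generate G {s0, s1} = {s0 [^] i \<otimes> s1 [^] j | (i::int) (j::int). True}" (is "_ = ?W")
proof
  have word: "s0 [^] i \<otimes> s1 [^] j = power_word s0 s1 \<one> i j 0" for i j :: int
    using assms unfolding power_word_def by simp
  have W: "power_word s0 s1 \<one> i j 0 \<in> ?W" for i j
    unfolding word[symmetric] by blast
  note gens = power_word_generators[OF assms A_closed(1)] and invs = power_word_inv[OF assms A_closed(1)]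
  have gen: "s0 \<in> ?W" "s1 \<in> ?W" "inv s0 \<in> ?W" "inv s1 \<in> ?W"
    using W[of 1 0] W[of 0 1] W[of "- 1" 0] W[of 0 "- 1"] gens invs[of 1 0 0] invs[of 0 1 0] by simp_all
  show "generate G {s0, s1} \<subseteq> ?W"
  proof
    fix x assume "x \<in> generate G {s0, s1}"
    then show "x \<in> ?W"
    proof induction
      case one
      then show ?case
        by (auto intro!: exI[of _ "0::int"])
    next
      case (eng x y)
      then show ?case
        using assms unfolding word by (auto simp: power_word_mult) blast
    qed (use gen in auto)
  qed
  have "subgroup (generate G {s0, s1}) G"
    using assms by (intro generate_is_subgroup) auto
  then show "?W \<subseteq> generate G {s0, s1}"
    by (auto intro!: subgroup.m_closed subgroup_int_pow_closed intro: generate.incl)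
qed

text \<open>
  Mapping \<open>s0\<close>, \<open>s1\<close>, \<open>s2\<close> to \<open>1\<close>, \<open>w1\<close>, \<open>w2\<close> defines a homomorphism from \<open>\<langle>s0, s1, s2\<rangle>\<close> to \<open>\<int>/5\<close>.
\<close>

definition mod_five_weights :: "'a \<Rightarrow> 'a \<Rightarrow> 'a \<Rightarrow> int \<Rightarrow> int \<Rightarrow> bool" where
  "mod_five_weights s0 s1 s2 w1 w2 \<longleftrightarrow>
    (\<forall>i j k. power_word s0 s1 s2 i j k = \<one> \<longrightarrow> 5 dvd i + w1 * j + w2 * k)"

text \<open>If 5 divides the order n of \<open>s\<close>, then \<open>s^5\<close> has order n/5, so
  \<alpha> matters only modulo n/5. As n/5 is positive, the subtraction in the range is not
  truncated.\<close>

lemma five_multiple_reduce: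
  assumes s: "s \<in> A" and n: "5 dvd ord s"
  obtains \<beta> :: nat where "\<beta> \<in> {0..ord s div 5 - 1}" "s [^] (5 * \<alpha> + c) = s [^] (5 * int \<beta> + c)"
proof -
  define q where "q = ord s div 5"
  have q: "ord s = 5 * q"
    using n unfolding q_def by simp
  have "0 < ord s"
    using ord_ge_1[OF finite_carrier, of s] s by simp
  then have "0 < q"
    using q by simp
  define \<beta> where "\<beta> = nat (\<alpha> mod int q)"
  have \<beta>: "int \<beta> = \<alpha> mod int q"
    using \<open>0 < q\<close> unfolding \<beta>_def by simp
  have "\<beta> < q"
    using \<open>0 < q\<close> \<beta> by (metis of_nat_0_less_iff of_nat_less_iff pos_mod_bound)
  moreover have "int (ord s) dvd (5 * \<alpha> + c) - (5 * int \<beta> + c)"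
    unfolding q \<beta> by (simp add: minus_mod_eq_mult_div flip: right_diff_distrib)
  then have "s [^] (5 * \<alpha> + c) = s [^] (5 * int \<beta> + c)"
    using s by (simp add: int_pow_eq dvd_diff_commute)
  ultimately show thesis
    using that[of \<beta>] unfolding q_def by auto
qed

text \<open>All relations between \<open>s0\<close> and \<open>s1\<close> follow from
  \<open>s0^n = 1\<close> and \<open>s1^m = s0^k\<close>. The weights 1 and \<open>w\<close> respect
  them exactly when 5 divides n and k is congruent to \<open>w m\<close>.\<close>

lemma mod_five_weights_pair_iff:
  assumes s: "s0 \<in> A" "s1 \<in> A"
  defines "n \<equiv> ord s0" and "m \<equiv> least_exponent_into G s1 (generate G {s0})"
  shows "5 dvd n \<and> (\<exists>\<alpha>\<in>{0..n div 5 - 1}. s1 [^] m = s0 [^] (5 * int \<alpha> + w * int m)) \<longleftrightarrow>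
    mod_five_weights s0 s1 \<one> w 0"
proof
  have gen: "generate G {s0} = {s0 [^] (k::int) | k. True}"
    using generate_pow[of s0] s by simp
  have sub: "subgroup (generate G {s0}) G"
    using s by (intro generate_is_subgroup) auto
  note m = least_exponent_into[OF sub finite_carrier A_carrier[OF s(2)], folded m_def]
  have word: "power_word s0 s1 \<one> i j k = s0 [^] i \<otimes> s1 [^] j" for i j k
    using s unfolding power_word_def by simp
  {
    assume L: "5 dvd n \<and> (\<exists>\<alpha>\<in>{0..n div 5 - 1}. s1 [^] m = s0 [^] (5 * int \<alpha> + w * int m))"
    then obtain \<alpha> :: nat where \<alpha>: "s1 [^] int m = s0 [^] (5 * int \<alpha> + w * int m)"
      by (auto simp: int_pow_int)
    show "mod_five_weights s0 s1 \<one> w 0"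
      unfolding mod_five_weights_def
    proof (intro allI impI)
      fix i j k assume "power_word s0 s1 \<one> i j k = \<one>"
      then have ij: "s0 [^] i \<otimes> s1 [^] j = \<one>"
        unfolding word .
      then have "s1 [^] j = s0 [^] (- i)"
        using s by (metis A_carrier A_commute A_int_pow int_pow_closed int_pow_neg inv_equality)
      then have "int m dvd j"
        using m(3)[of j] unfolding gen by auto
      then obtain q where q: "j = int m * q" ..
      have "s1 [^] j = s0 [^] ((5 * int \<alpha> + w * int m) * q)"
        using s \<alpha> unfolding q by (simp flip: int_pow_pow)
      with ij s have "s0 [^] (i + (5 * int \<alpha> + w * int m) * q) = \<one>"
        by (simp add: int_pow_mult)
      then have "int n dvd i + (5 * int \<alpha> + w * int m) * q"
        using s unfolding n_def by (simp add: int_pow_eq_id)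
      moreover have "5 dvd int n"
        using L by (simp add: int_dvd_int_iff[of 5 n, simplified])
      ultimately have "5 dvd i + (5 * int \<alpha> + w * int m) * q"
        by (rule dvd_trans[rotated])
      also have "i + (5 * int \<alpha> + w * int m) * q = i + w * j + 0 * k + 5 * (int \<alpha> * q)"
        unfolding q by (simp add: algebra_simps)
      finally show "5 dvd i + w * j + 0 * k"
        by (simp add: dvd_add_left_iff)
    qed
  }
  {
    assume R: "mod_five_weights s0 s1 \<one> w 0"
    have rel: "5 dvd i + w * j" if "s0 [^] i \<otimes> s1 [^] j = \<one>" for i j
      using R that unfolding mod_five_weights_def word by auto
    have "5 dvd int n"
      using rel[of "int n" 0] s unfolding n_def by (simp add: int_pow_int)
    then have n: "5 dvd n" by presburger
    obtain k :: int where k: "s1 [^] int m = s0 [^] k"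
      using m(2) unfolding gen by (auto simp: int_pow_int)
    have "s0 [^] k \<otimes> s1 [^] (- int m) = \<one>"
      using s k by (simp add: int_pow_neg flip: k)
    from rel[OF this] obtain \<alpha> where "k + w * (- int m) = 5 * \<alpha>" ..
    then have \<alpha>: "k = 5 * \<alpha> + w * int m"
      by simp
    obtain \<beta> where "\<beta> \<in> {0..n div 5 - 1}" "s0 [^] k = s0 [^] (5 * int \<beta> + w * int m)"
      using five_multiple_reduce[OF s(1) n[unfolded n_def], of \<alpha> "w * int m"] unfolding \<alpha> n_def by blast
    then show "5 dvd n \<and> (\<exists>\<alpha>\<in>{0..n div 5 - 1}. s1 [^] m = s0 [^] (5 * int \<alpha> + w * int m))"
      using n k by (auto simp: int_pow_int)
  }
qed

text \<open>To the relations of the pair comes a single new one, which expresses \<open>s2^l\<close>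
  by \<open>s0\<close> and \<open>s1\<close>. The weights respect \<open>s2^l = s0^i s1^j\<close>
  exactly when i is congruent to \<open>a j - b l\<close>.\<close>

lemma mod_five_weights_triple_iff:
  assumes s: "s0 \<in> A" "s1 \<in> A" "s2 \<in> A"
  defines "n \<equiv> ord s0" and "m \<equiv> least_exponent_into G s1 (generate G {s0})"
    and "l \<equiv> least_exponent_into G s2 (generate G {s0, s1})"
  shows "5 dvd n \<and> (\<exists>\<alpha>\<in>{0..n div 5 - 1}. \<exists>\<beta>\<in>{0..n div 5 - 1}. \<exists>j\<in>{0..m - 1}.
      s1 [^] m = s0 [^] (5 * int \<alpha> - a * int m) \<and>
      s2 [^] l = s0 [^] (5 * int \<beta> - b * int l + a * int j) \<otimes> s1 [^] j) \<longleftrightarrow>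
    mod_five_weights s0 s1 s2 (- a) (- b)" (is "?L \<longleftrightarrow> ?R")
proof
  note pair = mod_five_weights_pair_iff[OF s(1,2), of "- a", folded n_def m_def]
  have sub0: "subgroup (generate G {s0}) G"
    using s by (intro generate_is_subgroup) auto
  note m = least_exponent_into[OF sub0 finite_carrier A_carrier[OF s(2)], folded m_def]
  note gen = generate_pair[OF s(1,2)]
  have mem: "s0 [^] i \<otimes> s1 [^] j \<in> generate G {s0, s1}" for i j :: int
    unfolding gen by blast
  have sub: "subgroup (generate G {s0, s1}) G"
    using s by (intro generate_is_subgroup) auto
  note l = least_exponent_into[OF sub finite_carrier A_carrier[OF s(3)], folded l_def]
  have word0: "s0 [^] i \<otimes> s1 [^] j = power_word s0 s1 s2 i j 0" for i j :: int
    using s unfolding power_word_def by simp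
  have word2: "s2 [^] k = power_word s0 s1 s2 0 0 k" for k :: int
    using s unfolding power_word_def by simp
  have word1: "s1 [^] k = power_word s0 s1 s2 0 k 0" for k :: int
    using s unfolding power_word_def by simp
  note eq_iff = power_word_eq_iff[OF s]
  {
    assume ?L
    then obtain \<beta> j' :: nat where n: "5 dvd n"
      and pr: "mod_five_weights s0 s1 \<one> (- a) 0"
      and \<beta>: "s2 [^] int l = s0 [^] (5 * int \<beta> - b * int l + a * int j') \<otimes> s1 [^] int j'"
      using pair by (auto simp: int_pow_int)
    show ?R
      unfolding mod_five_weights_def
    proof (intro allI impI)
      fix i j k assume ijk: "power_word s0 s1 s2 i j k = \<one>"
      then have "s2 [^] k = s0 [^] (- i) \<otimes> s1 [^] (- j)"
        using eq_iff[of 0 0 k "- i" "- j" 0] unfolding word0 word2 by simp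
      then have "int l dvd k"
        using l(3)[of k] mem by simp
      then obtain q where q: "k = int l * q" ..
      let ?c = "5 * int \<beta> - b * int l + a * int j'"
      have "power_word s0 s1 s2 0 0 k = power_word s0 s1 s2 (?c * q) (int j' * q) 0"
        using arg_cong[OF \<beta>, of "\<lambda>x. x [^] q"] s unfolding word0 word2 q by (simp add: power_word_int_pow)
      then have "power_word s0 s1 s2 i j k = power_word s0 s1 s2 (i + ?c * q) (j + int j' * q) 0"
        using power_word_mult[OF s, of i j 0 0 0 k] power_word_mult[OF s, of i j 0 "?c * q" "int j' * q" 0]
        by simp
      with ijk have "s0 [^] (i + ?c * q) \<otimes> s1 [^] (j + int j' * q) = \<one>"
        unfolding word0 by simp
      then have "power_word s0 s1 \<one> (i + ?c * q) (j + int j' * q) 0 = \<one>"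
        using s unfolding power_word_def by simp
      then have "5 dvd (i + ?c * q) + (- a) * (j + int j' * q) + 0 * 0"
        using pr unfolding mod_five_weights_def by blast
      also have "(i + ?c * q) + (- a) * (j + int j' * q) + 0 * 0 = i + - a * j + - b * k + 5 * (int \<beta> * q)"
        unfolding q by (simp add: algebra_simps)
      finally show "5 dvd i + - a * j + - b * k"
        by (simp add: dvd_add_left_iff)
    qed
  }
  {
    assume ?R
    then have rel: "5 dvd i + - a * j + - b * k" if "power_word s0 s1 s2 i j k = \<one>" for i j k
      using that unfolding mod_five_weights_def by blast
    have "mod_five_weights s0 s1 \<one> (- a) 0"
      unfolding mod_five_weights_def
    proof (intro allI impI)
      fix i j k assume "power_word s0 s1 \<one> i j k = \<one>"
      then have "power_word s0 s1 s2 i j 0 = \<one>"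
        using s unfolding power_word_def by simp
      from rel[OF this] show "5 dvd i + - a * j + 0 * k" by simp
    qed
    then obtain \<alpha> where n: "5 dvd n" and \<alpha>: "\<alpha> \<in> {0..n div 5 - 1}" "s1 [^] m = s0 [^] (5 * int \<alpha> + - a * int m)"
      using pair by blast
    obtain i j :: int where ij: "s2 [^] int l = s0 [^] i \<otimes> s1 [^] j"
      using l(2) unfolding gen by (auto simp: int_pow_int)
    \<comment> \<open>The relation for \<open>s1^m\<close> brings the exponent of \<open>s1\<close>
      below \<open>m\<close>, at the cost of changing the exponent of \<open>s0\<close>.\<close>
    define j' where "j' = nat (j mod int m)"
    have j': "int j' = j mod int m" "j' < m"
      using m(1) unfolding j'_def by (auto simp: nat_less_iff)
    let ?c = "5 * int \<alpha> + - a * int m"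
    let ?q = "j div int m"
    have j: "j = int j' + int m * ?q"
      unfolding j' by simp
    have "s1 [^] (int m * ?q) = s0 [^] (?c * ?q)"
      using \<alpha>(2) s by (simp add: int_pow_int flip: int_pow_pow)
    then have "s2 [^] int l = s0 [^] (i + ?c * ?q) \<otimes> s1 [^] int j'"
      using s unfolding ij by (subst j) (simp add: int_pow_mult A_ac)
    moreover define i' where "i' = i + ?c * ?q"
    ultimately have i': "s2 [^] int l = s0 [^] i' \<otimes> s1 [^] int j'"
      by simp
    then have "power_word s0 s1 s2 i' (int j') (- int l) = \<one>"
      using eq_iff[of i' "int j'" 0 0 0 "int l"] unfolding word0 word2 by simp
    from rel[OF this] obtain \<beta>' where "i' + - a * int j' + - b * (- int l) = 5 * \<beta>'" ..
    then have \<beta>': "i' = 5 * \<beta>' + (a * int j' - b * int l)"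
      by simp
    obtain \<beta> where "\<beta> \<in> {0..n div 5 - 1}" "s0 [^] i' = s0 [^] (5 * int \<beta> + (a * int j' - b * int l))"
      using five_multiple_reduce[OF s(1) n[unfolded n_def], of \<beta>' "a * int j' - b * int l"]
      unfolding \<beta>' n_def by blast
    moreover have "j' \<in> {0..m - 1}"
      using j'(2) by simp
    ultimately show ?L
      using n \<alpha> i' by (intro conjI n bexI[of _ \<alpha>] bexI[of _ \<beta>] bexI[of _ j']) (simp_all add: int_pow_int algebra_simps)
  }
qed

end

section \<open>Necessity and sufficiency\<close>

lemma of_bool_disj_exclusive: "\<not> (p \<and> q) \<Longrightarrow> of_bool (p \<or> q) = (of_bool p + of_bool q :: nat)"
  by auto

text \<open>For an involution b in \<open>S\<close>, these are the equations at x and x b: the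
  indicators \<open>a0\<close> and \<open>a1\<close> of the two adjacent points occur in both, every
  other term in one.\<close>

lemma add_pair_eq_2:
  fixes a0 a1 :: nat
  assumes "a0 + a1 + c0 + d0 + e0 = 1" and "a1 + a0 + c1 + d1 + e1 = 1"
  shows "2 * (a0 + a1) + (c0 + c1) + (d0 + d1) + (e0 + e1) = 2"
  using assms by simp

context generalized_dihedral
begin

section \<open>From codes to weights modulo 5, and the excluded cases\<close>

lemma power_word_shift:
  assumes "x \<in> A" "s0 \<in> A" "s1 \<in> A" "s2 \<in> A"
  shows "x \<otimes> power_word s0 s1 s2 i j k \<otimes> s0 = x \<otimes> power_word s0 s1 s2 (i + 1) j k"
    and "x \<otimes> power_word s0 s1 s2 i j k \<otimes> s1 = x \<otimes> power_word s0 s1 s2 i (j + 1) k"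
    and "x \<otimes> power_word s0 s1 s2 i j k \<otimes> s2 = x \<otimes> power_word s0 s1 s2 i j (k + 1)"
    and "x \<otimes> power_word s0 s1 s2 i j k \<otimes> inv s0 = x \<otimes> power_word s0 s1 s2 (i - 1) j k"
    and "x \<otimes> power_word s0 s1 s2 i j k \<otimes> inv s1 = x \<otimes> power_word s0 s1 s2 i (j - 1) k"
    and "x \<otimes> power_word s0 s1 s2 i j k \<otimes> inv s2 = x \<otimes> power_word s0 s1 s2 i j (k - 1)"
proof -
  note [simp] = assms
  have s: "s0 = power_word s0 s1 s2 1 0 0" "s1 = power_word s0 s1 s2 0 1 0" "s2 = power_word s0 s1 s2 0 0 1"
    by (simp_all add: power_word_generators)
  have i: "inv s0 = power_word s0 s1 s2 (- 1) 0 0" "inv s1 = power_word s0 s1 s2 0 (- 1) 0"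
    "inv s2 = power_word s0 s1 s2 0 0 (- 1)"
    using power_word_inv[of s0 s1 s2 1 0 0] power_word_inv[of s0 s1 s2 0 1 0] power_word_inv[of s0 s1 s2 0 0 1]
    by (simp_all add: power_word_generators)
  have "x \<otimes> power_word s0 s1 s2 i j k \<otimes> power_word s0 s1 s2 i' j' k' = x \<otimes> power_word s0 s1 s2 (i + i') (j + j') (k + k')"
    for i' j' k'
    by (simp add: m_assoc power_word_mult)
  from this[of 1 0 0] this[of 0 1 0] this[of 0 0 1] this[of "- 1" 0 0] this[of 0 "- 1" 0] this[of 0 0 "- 1"]
  show "x \<otimes> power_word s0 s1 s2 i j k \<otimes> s0 = x \<otimes> power_word s0 s1 s2 (i + 1) j k"
    "x \<otimes> power_word s0 s1 s2 i j k \<otimes> s1 = x \<otimes> power_word s0 s1 s2 i (j + 1) k"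
    "x \<otimes> power_word s0 s1 s2 i j k \<otimes> s2 = x \<otimes> power_word s0 s1 s2 i j (k + 1)"
    "x \<otimes> power_word s0 s1 s2 i j k \<otimes> inv s0 = x \<otimes> power_word s0 s1 s2 (i - 1) j k"
    "x \<otimes> power_word s0 s1 s2 i j k \<otimes> inv s1 = x \<otimes> power_word s0 s1 s2 i (j - 1) k"
    "x \<otimes> power_word s0 s1 s2 i j k \<otimes> inv s2 = x \<otimes> power_word s0 s1 s2 i j (k - 1)"
    by (simp_all add: power_word_generators flip: i)
qed

lemma code_systemD:
  assumes "code_system B C D E" and "x \<in> A"
  shows "(\<Sum>b\<in>insert \<one> B. of_bool (x \<otimes> b \<in> D)) + (\<Sum>c\<in>C. of_bool (x \<otimes> c \<in> E)) = (1::nat)"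
    and "(\<Sum>b\<in>insert \<one> B. of_bool (x \<otimes> b \<in> E)) + (\<Sum>c\<in>C. of_bool (x \<otimes> inv c \<in> D)) = (1::nat)"
  using assms unfolding code_system_def by blast+

lemma involution_power_word:
  assumes "x \<in> A" "s0 \<in> A" "s1 \<in> A" "s2 \<in> A"
  shows "inv s0 = s0 \<Longrightarrow> x \<otimes> power_word s0 s1 s2 (i + 2) j k = x \<otimes> power_word s0 s1 s2 i j k"
    and "inv s1 = s1 \<Longrightarrow> x \<otimes> power_word s0 s1 s2 i (j + 2) k = x \<otimes> power_word s0 s1 s2 i j k"
    and "inv s2 = s2 \<Longrightarrow> x \<otimes> power_word s0 s1 s2 i j (k + 2) = x \<otimes> power_word s0 s1 s2 i j k"
  using power_word_shift(1,4)[OF assms, of "i + 1" j k] power_word_shift(2,5)[OF assms, of i "j + 1" k]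
    power_word_shift(3,6)[OF assms, of i j "k + 1"] by (simp_all add: add.commute)

text \<open>The lattice gives four axis weights, of which only differences are determined by the
  group, because one of the four axes belongs to the identity. Shifting and scaling them to 0, 1,
  -a, -b yields the normal form.\<close>

lemma code_system_quadruple:
  assumes code: "code_system {} {\<one>, s0, s1, s2} D E" and DE: "D \<subseteq> A" "E \<subseteq> A"
    and s: "s0 \<in> A" "s1 \<in> A" "s2 \<in> A" and dist: "distinct [\<one>, s0, s1, s2]"
  obtains a b where "a \<in> {1, 2, 3}" "b \<in> {1, 2, 3}" "a \<noteq> b" "mod_five_weights s0 s1 s2 (- a) (- b)"
proof -
  note eq = code_systemD[OF code]
  have eq0: "of_bool (x \<in> D) + of_bool (x \<in> E) + of_bool (x \<otimes> s0 \<in> E) + of_bool (x \<otimes> s1 \<in> E)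
      + of_bool (x \<otimes> s2 \<in> E) = (1::nat)"
    and eq1: "of_bool (x \<in> E) + of_bool (x \<in> D) + of_bool (x \<otimes> inv s0 \<in> D) + of_bool (x \<otimes> inv s1 \<in> D)
      + of_bool (x \<otimes> inv s2 \<in> D) = (1::nat)" if "x \<in> A" for x
    using eq[OF that] dist that by (simp_all add: ac_simps del: sum_of_bool_eq)
  obtain x where x: "x \<in> D"
  proof (cases "D = {}")
    case True
    then have "x \<in> E" if "x \<in> A" for x
      using eq1[OF that] by (cases "x \<in> E") simp_all
    then show thesis
      using eq0[of \<one>] s by auto
  qed (use that in blast)
  then have xA: "x \<in> A"
    using DE by blast
  let ?w = "power_word s0 s1 s2"
  \<comment> \<open>The first axis stands for the element 1 of \<open>C\<close>, so the code does
    not depend on its coordinate.\<close>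
  define P Q :: "int \<Rightarrow> int \<Rightarrow> int \<Rightarrow> int \<Rightarrow> bool"
    where "P = (\<lambda>_ i j k. x \<otimes> ?w i j k \<in> D)" and "Q = (\<lambda>_ i j k. x \<otimes> ?w i j k \<in> E)"
  have code': "diamond_code P Q"
    unfolding diamond_code_def P_def Q_def
    using eq0[of "x \<otimes> ?w _ _ _"] eq1[of "x \<otimes> ?w _ _ _"] xA s
    unfolding power_word_shift[OF xA s] by simp
  have "P 0 0 0 0"
    unfolding P_def using x xA by simp
  from diamond_code_lattice[OF code' this]
  obtain x0 x1 x2 x3 :: int where xs: "distinct [x0, x1, x2, x3]" "{x0, x1, x2, x3} = {1, 2, 3, 4}"
    and P: "\<And>a b c d. P a b c d \<Longrightarrow> a + b + c + d = 0 \<Longrightarrow> 5 dvd a * x0 + b * x1 + c * x2 + d * x3"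
    by blast
  text \<open>By Fermat, the cube of \<open>x1 - x0\<close> is its inverse modulo 5.\<close>
  define u where "u = (x1 - x0) ^ 3"
  define a where "a = (- u * (x2 - x0)) mod 5"
  define b where "b = (- u * (x3 - x0)) mod 5"
  have r: "x0 \<in> {1, 2, 3, 4}" "x1 \<in> {1, 2, 3, 4}" "x2 \<in> {1, 2, 3, 4}" "x3 \<in> {1, 2, 3, 4}"
    using xs(2) by auto
  have d: "x0 \<noteq> x1" "x0 \<noteq> x2" "x0 \<noteq> x3" "x1 \<noteq> x2" "x1 \<noteq> x3" "x2 \<noteq> x3"
    using xs(1) by auto
  have ab: "a \<in> {1, 2, 3}" "b \<in> {1, 2, 3}" and u: "5 dvd u * (x1 - x0) - 1"
    using distinct_residues_five[OF r(1,2,3) d(1,2,4)] distinct_residues_five[OF r(1,2,4) d(1,3,5)]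
    unfolding a_def b_def u_def by blast+
  have "a \<noteq> b"
  proof
    assume "a = b"
    then have "5 dvd - u * (x2 - x0) - - u * (x3 - x0)"
      unfolding a_def b_def by (simp only: mod_eq_dvd_iff)
    then have "5 dvd (x1 - x0) * (- u * (x2 - x0) - - u * (x3 - x0)) - (u * (x1 - x0) - 1) * (x3 - x2)"
      using u by (rule dvd_diff[OF dvd_mult dvd_mult2])
    also have "(x1 - x0) * (- u * (x2 - x0) - - u * (x3 - x0)) - (u * (x1 - x0) - 1) * (x3 - x2) = x3 - x2"
      by (simp add: algebra_simps)
    finally show False
      using r(3,4) d(6) by auto
  qed
  have "5 dvd - u * (x2 - x0) - a" "5 dvd - u * (x3 - x0) - b"
    unfolding a_def b_def by (simp_all only: mod_eq_0_iff_dvd[symmetric] mod_diff_right_eq diff_self mod_0)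
  with u obtain e0 e1 e2 where e: "u * (x1 - x0) - 1 = 5 * e0" "- u * (x2 - x0) - a = 5 * e1" "- u * (x3 - x0) - b = 5 * e2"
    by (auto elim!: dvdE)
  have "mod_five_weights s0 s1 s2 (- a) (- b)"
    unfolding mod_five_weights_def
  proof (intro allI impI)
    fix i j k assume "?w i j k = \<one>"
    \<comment> \<open>A trivial word leads back to the code point \<open>x\<close>; the free first
      coordinate is chosen to make the sum 0.\<close>
    then have "P (- i - j - k) i j k"
      unfolding P_def using x xA by simp
    from P[OF this] have "5 dvd (- i - j - k) * x0 + i * x1 + j * x2 + k * x3"
      by simp
    then have "5 dvd u * ((- i - j - k) * x0 + i * x1 + j * x2 + k * x3)"
      by (rule dvd_mult)
    also have "u * ((- i - j - k) * x0 + i * x1 + j * x2 + k * x3)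
        = i * (u * (x1 - x0)) - j * (- u * (x2 - x0)) - k * (- u * (x3 - x0))"
      by (simp add: algebra_simps)
    also have "\<dots> = i + - a * j + - b * k + 5 * (i * e0 - j * e1 - k * e2)"
    proof -
      have "u * (x1 - x0) = 1 + 5 * e0" "- u * (x2 - x0) = a + 5 * e1" "- u * (x3 - x0) = b + 5 * e2"
        using e by linarith+
      then show ?thesis
        by (simp only:) (simp add: algebra_simps)
    qed
    finally show "5 dvd i + - a * j + - b * k"
      by (simp add: dvd_add_left_iff)
  qed
  with ab \<open>a \<noteq> b\<close> show thesis
    using that by blast
qed

text \<open>Rows of the grid alternate between \<open>A\<close> and \<open>t A\<close>, so a step by
  \<open>s0\<close> within \<open>A\<close> has length 2. On even columns the condition
  \<open>5 dvd x - 2 * y\<close>, or its mirror image, becomes twice \<open>i - j\<close> or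
  \<open>i + j\<close>, whence the weights -1 and 1.\<close>

lemma code_system_cyclic_pair:
  assumes code: "code_system {s1, inv s1} {\<one>, s0} D E" and DE: "D \<subseteq> A" "E \<subseteq> A"
    and s: "s0 \<in> A" "s1 \<in> A" and dist: "distinct [\<one>, s1, inv s1]" "s0 \<noteq> \<one>"
  shows "mod_five_weights s0 s1 \<one> 1 0 \<or> mod_five_weights s0 s1 \<one> (- 1) 0"
proof -
  note eq = code_systemD[OF code]
  have eq0: "of_bool (x \<in> D) + of_bool (x \<otimes> s0 \<in> E) + of_bool (x \<in> E) + of_bool (x \<otimes> s1 \<in> D)
      + of_bool (x \<otimes> inv s1 \<in> D) = (1::nat)"
    and eq1: "of_bool (x \<in> E) + of_bool (x \<in> D) + of_bool (x \<otimes> inv s0 \<in> D) + of_bool (x \<otimes> s1 \<in> E)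
      + of_bool (x \<otimes> inv s1 \<in> E) = (1::nat)" if "x \<in> A" for x
    using eq[OF that] dist that by (simp_all add: ac_simps del: sum_of_bool_eq)
  let ?w = "\<lambda>i j. power_word s0 s1 \<one> i j 0"
  text \<open>
    In the square grid, the element \<open>s0 [^] i \<otimes> s1 [^] j\<close> of \<open>A\<close> sits at \<open>(2 i, j)\<close> and its \<open>t\<close>-translate
    at \<open>(2 i - 1, j)\<close>.
  \<close>
  define P where "P = (\<lambda>x i j. if even i then x \<otimes> ?w (i div 2) j \<in> D else x \<otimes> ?w ((i + 1) div 2) j \<in> E)"
  have code': "square_code (P x)" if x: "x \<in> A" for x
    unfolding square_code_def
  proof (intro allI)
    fix i j :: int
    note shift = power_word_shift[OF x s A_closed(1)]
    show "of_bool (P x i j) + of_bool (P x (i + 1) j) + of_bool (P x (i - 1) j)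
        + of_bool (P x i (j + 1)) + of_bool (P x i (j - 1)) = (1::nat)"
    proof (cases "even i")
      case True
      then obtain h where h: "i = 2 * h" ..
      have P: "P x i j \<longleftrightarrow> x \<otimes> ?w h j \<in> D" "P x (i + 1) j \<longleftrightarrow> x \<otimes> ?w (h + 1) j \<in> E"
        "P x (i - 1) j \<longleftrightarrow> x \<otimes> ?w h j \<in> E" for j
        unfolding P_def h by (simp_all add: add.commute)
      show ?thesis
        using eq0[of "x \<otimes> ?w h j"] x s unfolding shift P by simp_all
    next
      case False
      then have "even (i + 1)" by simp
      then obtain h where "i + 1 = 2 * h" ..
      then have h: "i = 2 * h - 1" by simp
      have "(2 * h - 2) div 2 = h - 1"
        by simp
      then have P: "P x i j \<longleftrightarrow> x \<otimes> ?w h j \<in> E" "P x (i + 1) j \<longleftrightarrow> x \<otimes> ?w h j \<in> D"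
        "P x (i - 1) j \<longleftrightarrow> x \<otimes> ?w (h - 1) j \<in> D" for j
        unfolding P_def h by simp_all
      show ?thesis
        using eq1[of "x \<otimes> ?w h j"] x s unfolding shift P by simp_all
    qed
  qed
  obtain x where x: "x \<in> D"
  proof -
    obtain i j where P: "P \<one> i j"
      using code'[OF A_closed(1), unfolded square_code_def of_bool_sum5_eq_1, THEN spec, THEN spec, of 0 0] by blast
    \<comment> \<open>An even column is needed to find a code point in \<open>D\<close>. Both
      chiralities contain a knight move of horizontal length 1, which changes the parity.\<close>
    have "P \<one> (i + 1) (j - 2) \<or> P \<one> (i + 1) (j + 2)"
      using square_code_local(1)[OF code'[OF A_closed(1)] P] unfolding knight_pattern_def by blast
    moreover have "even i \<or> even (i + 1)"
      by simp
    ultimately obtain i' j' where "even i'" "P \<one> i' j'"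
      using P by blast
    then show thesis
      using that[of "\<one> \<otimes> ?w (i' div 2) j'"] unfolding P_def by simp
  qed
  then have xA: "x \<in> A"
    using DE by blast
  have "P x 0 0"
    unfolding P_def using x xA by simp
  from square_code_lattice[OF code'[OF xA] this]
  have *: "(\<forall>i j. P x i j \<longrightarrow> 5 dvd i - 2 * j) \<or> (\<forall>i j. P x i j \<longrightarrow> 5 dvd i + 2 * j)" .
  have P: "P x (2 * i) j" if "power_word s0 s1 \<one> i j k = \<one>" for i j k
  proof -
    have "?w i j = \<one>"
      using that unfolding power_word_def by simp
    then show ?thesis
      unfolding P_def using x xA by simp
  qed
  have half: "5 dvd i + c * j" if "5 dvd 2 * i + 2 * (c * j)" for i j c :: int
    using that by presburger
  from * show ?thesis
  proof
    assume "\<forall>i j. P x i j \<longrightarrow> 5 dvd i - 2 * j"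
    then have "5 dvd 2 * i + 2 * (- 1 * j)" if "power_word s0 s1 \<one> i j k = \<one>" for i j k
      using P[OF that] by auto
    then show ?thesis
      unfolding mod_five_weights_def using half[of _ "- 1"] by simp
  next
    assume "\<forall>i j. P x i j \<longrightarrow> 5 dvd i + 2 * j"
    then have "5 dvd 2 * i + 2 * (1 * j)" if "power_word s0 s1 \<one> i j k = \<one>" for i j k
      using P[OF that] by auto
    then show ?thesis
      unfolding mod_five_weights_def using half[of _ 1] by simp
  qed
qed

lemma no_code_system_two_involutions:
  assumes code: "code_system {b1, b2} {\<one>, s0} D E"
    and s: "b1 \<in> A" "b2 \<in> A" "s0 \<in> A" and inv: "inv b1 = b1" "inv b2 = b2"
    and dist: "distinct [\<one>, b1, b2]" "s0 \<noteq> \<one>"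
  shows False
proof -
  note eq = code_systemD[OF code]
  have eq0: "of_bool (x \<in> D) + of_bool (x \<otimes> b1 \<in> D) + of_bool (x \<otimes> b2 \<in> D) + of_bool (x \<in> E)
      + of_bool (x \<otimes> s0 \<in> E) = (1::nat)"
    and eq1: "of_bool (x \<in> E) + of_bool (x \<otimes> b1 \<in> E) + of_bool (x \<otimes> b2 \<in> E) + of_bool (x \<in> D)
      + of_bool (x \<otimes> inv s0 \<in> D) = (1::nat)" if "x \<in> A" for x
    using eq[OF that] dist that by (simp_all add: ac_simps del: sum_of_bool_eq)
  let ?w = "\<lambda>i j k. \<one> \<otimes> power_word b1 b2 s0 i j k"
  note shift = power_word_shift[OF A_closed(1) s]
  note per = involution_power_word[OF A_closed(1) s]
  have w: "?w i j k \<in> A" for i j k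
    using s by simp
  show False
  proof (rule no_code_two_involutions[of "\<lambda>i j k. ?w i j k \<in> D" "\<lambda>i j k. ?w i j k \<in> E"])
    fix i j k
    show "of_bool (?w i j k \<in> D) + of_bool (?w (i + 1) j k \<in> D) + of_bool (?w i (j + 1) k \<in> D)
        + of_bool (?w i j k \<in> E) + of_bool (?w i j (k + 1) \<in> E) = (1::nat)"
      using eq0[OF w[of i j k]] unfolding shift .
    show "of_bool (?w i j k \<in> E) + of_bool (?w (i + 1) j k \<in> E) + of_bool (?w i (j + 1) k \<in> E)
        + of_bool (?w i j k \<in> D) + of_bool (?w i j (k - 1) \<in> D) = (1::nat)"
      using eq1[OF w[of i j k]] unfolding shift .
  qed (simp_all only: per inv)
qed

lemma no_code_system_three_involutions:
  assumes code: "code_system {b1, b2, b3} {\<one>} D E"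
    and s: "b1 \<in> A" "b2 \<in> A" "b3 \<in> A" and inv: "inv b1 = b1" "inv b2 = b2" "inv b3 = b3"
    and dist: "distinct [\<one>, b1, b2, b3]"
  shows False
proof -
  note eq = code_systemD[OF code]
  have eq0: "of_bool (x \<in> D) + of_bool (x \<otimes> b1 \<in> D) + of_bool (x \<otimes> b2 \<in> D) + of_bool (x \<otimes> b3 \<in> D)
      + of_bool (x \<in> E) = (1::nat)"
    and eq1: "of_bool (x \<in> E) + of_bool (x \<otimes> b1 \<in> E) + of_bool (x \<otimes> b2 \<in> E) + of_bool (x \<otimes> b3 \<in> E)
      + of_bool (x \<in> D) = (1::nat)" if "x \<in> A" for x
    using eq[OF that] dist that by (simp_all add: ac_simps del: sum_of_bool_eq)
  let ?w = "\<lambda>i j k. \<one> \<otimes> power_word b1 b2 b3 i j k"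
  note shift = power_word_shift[OF A_closed(1) s]
  note per = involution_power_word[OF A_closed(1) s]
  have w: "?w i j k \<in> A" for i j k
    using s by simp
  show False
  proof (rule no_code_three_involutions[of "\<lambda>i j k. ?w i j k \<in> D" "\<lambda>i j k. ?w i j k \<in> E"])
    fix i j k
    show "of_bool (?w i j k \<in> D) + of_bool (?w (i + 1) j k \<in> D) + of_bool (?w i (j + 1) k \<in> D)
        + of_bool (?w i j (k + 1) \<in> D) + of_bool (?w i j k \<in> E) = (1::nat)"
      using eq0[OF w[of i j k]] unfolding shift .
    show "of_bool (?w i j k \<in> E) + of_bool (?w (i + 1) j k \<in> E) + of_bool (?w i (j + 1) k \<in> E)
        + of_bool (?w i j (k + 1) \<in> E) + of_bool (?w i j k \<in> D) = (1::nat)"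
      using eq1[OF w[of i j k]] unfolding shift .
  qed (simp_all only: per inv)
qed

text \<open>Merging x with x b leaves a ladder whose rails come from \<open>D\<close> and
  \<open>E\<close>. Adjacent points are never both in the code, so the merged indicators still take
  only the values 0 and 1.\<close>

lemma no_code_system_involution_cyclic:
  assumes code: "code_system {a, inv a, b} {\<one>} D E"
    and s: "a \<in> A" "b \<in> A" and inv: "inv b = b" and dist: "distinct [\<one>, a, inv a, b]"
  shows False
proof -
  note eq = code_systemD[OF code]
  have eq0: "of_bool (x \<in> D) + of_bool (x \<otimes> b \<in> D) + of_bool (x \<otimes> inv a \<in> D) + of_bool (x \<otimes> a \<in> D)
      + of_bool (x \<in> E) = (1::nat)"
    and eq1: "of_bool (x \<in> E) + of_bool (x \<otimes> b \<in> E) + of_bool (x \<otimes> inv a \<in> E) + of_bool (x \<otimes> a \<in> E)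
      + of_bool (x \<in> D) = (1::nat)" if "x \<in> A" for x
    using eq[OF that] dist that by (simp_all add: ac_simps del: sum_of_bool_eq)
  let ?w = "\<lambda>i j. \<one> \<otimes> power_word a b \<one> i j 0"
  note shift = power_word_shift[OF A_closed(1) s A_closed(1)]
  have per: "?w i (1 + 1) = ?w i 0" for i
    using involution_power_word(2)[OF A_closed(1) s A_closed(1) inv, of i 0 0] by simp
  have w: "?w i j \<in> A" for i j
    using s by simp
  have excl: "\<not> (?w i 0 \<in> D \<and> ?w i 1 \<in> D)" "\<not> (?w i 0 \<in> E \<and> ?w i 1 \<in> E)" for i
    using eq0[OF w[of i 0]] eq1[OF w[of i 0]] unfolding shift add_0_left of_bool_sum5_eq_1 by blast+
  show False
  proof (rule no_ladder_code[of "\<lambda>i. ?w i 0 \<in> D \<or> ?w i 1 \<in> D" "\<lambda>i. ?w i 0 \<in> E \<or> ?w i 1 \<in> E"])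
    fix i
    note ex = excl[of i, THEN of_bool_disj_exclusive] excl[of "i + 1", THEN of_bool_disj_exclusive]
      excl[of "i - 1", THEN of_bool_disj_exclusive]
    show "2 * of_bool (?w i 0 \<in> D \<or> ?w i 1 \<in> D) + of_bool (?w (i - 1) 0 \<in> D \<or> ?w (i - 1) 1 \<in> D)
        + of_bool (?w (i + 1) 0 \<in> D \<or> ?w (i + 1) 1 \<in> D) + of_bool (?w i 0 \<in> E \<or> ?w i 1 \<in> E) = (2::nat)"
      using add_pair_eq_2[OF eq0[OF w[of i 0], unfolded shift add_0_left] eq0[OF w[of i 1], unfolded shift per]] unfolding ex .
    show "2 * of_bool (?w i 0 \<in> E \<or> ?w i 1 \<in> E) + of_bool (?w (i - 1) 0 \<in> E \<or> ?w (i - 1) 1 \<in> E)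
        + of_bool (?w (i + 1) 0 \<in> E \<or> ?w (i + 1) 1 \<in> E) + of_bool (?w i 0 \<in> D \<or> ?w i 1 \<in> D) = (2::nat)"
      using add_pair_eq_2[OF eq1[OF w[of i 0], unfolded shift add_0_left] eq1[OF w[of i 1], unfolded shift per]] unfolding ex .
  qed
qed

text \<open>Merging along the involution leaves three directions between the two kinds of vertices,
  those of the honeycomb.\<close>

lemma no_code_system_involution_triple:
  assumes code: "code_system {b} {\<one>, s0, s1} D E"
    and s: "s0 \<in> A" "s1 \<in> A" "b \<in> A" and inv: "inv b = b" and dist: "distinct [\<one>, s0, s1]" "b \<noteq> \<one>"
  shows False
proof -
  note eq = code_systemD[OF code]
  have eq0: "of_bool (x \<in> D) + of_bool (x \<otimes> b \<in> D) + of_bool (x \<in> E) + of_bool (x \<otimes> s0 \<in> E)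
      + of_bool (x \<otimes> s1 \<in> E) = (1::nat)"
    and eq1: "of_bool (x \<in> E) + of_bool (x \<otimes> b \<in> E) + of_bool (x \<in> D) + of_bool (x \<otimes> inv s0 \<in> D)
      + of_bool (x \<otimes> inv s1 \<in> D) = (1::nat)" if "x \<in> A" for x
    using eq[OF that] dist that by (simp_all add: ac_simps del: sum_of_bool_eq)
  let ?w = "\<lambda>i j k. \<one> \<otimes> power_word s0 s1 b i j k"
  note shift = power_word_shift[OF A_closed(1) s]
  have per: "?w i j (1 + 1) = ?w i j 0" for i j
    using involution_power_word(3)[OF A_closed(1) s inv, of i j 0] by simp
  have w: "?w i j k \<in> A" for i j k
    using s by simp
  have excl: "\<not> (?w i j 0 \<in> D \<and> ?w i j 1 \<in> D)" "\<not> (?w i j 0 \<in> E \<and> ?w i j 1 \<in> E)" for i j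
    using eq0[OF w[of i j 0]] eq1[OF w[of i j 0]] unfolding shift add_0_left of_bool_sum5_eq_1 by blast+
  show False
  proof (rule no_honeycomb_code[of "\<lambda>i j. ?w i j 0 \<in> D \<or> ?w i j 1 \<in> D" "\<lambda>i j. ?w i j 0 \<in> E \<or> ?w i j 1 \<in> E"])
    fix i j
    note ex = excl[of i j, THEN of_bool_disj_exclusive] excl[of "i + 1" j, THEN of_bool_disj_exclusive]
      excl[of i "j + 1", THEN of_bool_disj_exclusive] excl[of "i - 1" j, THEN of_bool_disj_exclusive]
      excl[of i "j - 1", THEN of_bool_disj_exclusive]
    show "2 * of_bool (?w i j 0 \<in> D \<or> ?w i j 1 \<in> D) + of_bool (?w i j 0 \<in> E \<or> ?w i j 1 \<in> E)
        + of_bool (?w (i + 1) j 0 \<in> E \<or> ?w (i + 1) j 1 \<in> E)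
        + of_bool (?w i (j + 1) 0 \<in> E \<or> ?w i (j + 1) 1 \<in> E) = (2::nat)"
      using add_pair_eq_2[OF eq0[OF w[of i j 0], unfolded shift add_0_left] eq0[OF w[of i j 1], unfolded shift per]] unfolding ex .
    show "2 * of_bool (?w i j 0 \<in> E \<or> ?w i j 1 \<in> E) + of_bool (?w i j 0 \<in> D \<or> ?w i j 1 \<in> D)
        + of_bool (?w (i - 1) j 0 \<in> D \<or> ?w (i - 1) j 1 \<in> D)
        + of_bool (?w i (j - 1) 0 \<in> D \<or> ?w i (j - 1) 1 \<in> D) = (2::nat)"
      using add_pair_eq_2[OF eq1[OF w[of i j 0], unfolded shift add_0_left] eq1[OF w[of i j 1], unfolded shift per]] unfolding ex .
  qed
qed

end

text \<open>The values 2, 3, 4 of \<open>v\<close> give the three two-element subsets of {1, 2, 3},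
  and the set equation admits both orders.\<close>

lemma pair_parity_sigma_iff:
  "(\<exists>v\<in>{2, 3, 4 :: int}. \<exists>a b :: int. {a, b} = {2 + parity_sigma v, v - parity_sigma v - 1} \<and> Q a b) \<longleftrightarrow>
    (\<exists>a\<in>{1, 2, 3}. \<exists>b\<in>{1, 2, 3}. a \<noteq> b \<and> Q a b)"
proof -
  have "parity_sigma 2 = 0" "parity_sigma 3 = 1" "parity_sigma 4 = 0"
    unfolding parity_sigma_def by simp_all
  then show ?thesis
    by (auto simp: doubleton_eq_iff)
qed

context generalized_dihedral
begin

lemma mod_five_weights_cyclic_pair_iff:
  assumes s: "s0 \<in> A" "s1 \<in> A"
  shows "(let n = ord s0; m = least_exponent_into G s1 (generate G {s0})
      in 5 dvd n \<and> (\<exists>u \<in> {2 * i | i::nat. i \<le> n div 5 - 1}.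
           s1 [^] m = s0 [^] (5 * int u div 2 + int m) \<or> s1 [^] m = s0 [^] (5 * int u div 2 - int m))) \<longleftrightarrow>
    mod_five_weights s0 s1 \<one> 1 0 \<or> mod_five_weights s0 s1 \<one> (- 1) 0"
proof -
  have half: "5 * int (2 * i) div 2 = 5 * int i" for i
    by simp
  have range: "(\<exists>u \<in> {2 * i | i::nat. i \<le> N}. Q u) \<longleftrightarrow> (\<exists>i\<in>{0..N}. Q (2 * i))" for N Q
    by (auto, blast)
  show ?thesis
    unfolding mod_five_weights_pair_iff[OF s, symmetric] Let_def range half by auto
qed

section \<open>From weights modulo 5 to codes\<close>

lemma ex_mod_five_function:
  assumes s: "s0 \<in> A" "s1 \<in> A" "s2 \<in> A" and w: "mod_five_weights s0 s1 s2 w1 w2"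
  obtains f where "\<And>i j k. f (power_word s0 s1 s2 i j k) = (i + w1 * j + w2 * k) mod 5"
proof -
  \<comment> \<open>The choice is harmless: two representations of the same word differ by a
    relation, on which the weights vanish modulo 5.\<close>
  define f where "f x = (SOME r. \<exists>i j k. x = power_word s0 s1 s2 i j k \<and> r = (i + w1 * j + w2 * k) mod 5)" for x
  have "f (power_word s0 s1 s2 i j k) = (i + w1 * j + w2 * k) mod 5" for i j k
  proof -
    have "\<exists>i' j' k'. power_word s0 s1 s2 i j k = power_word s0 s1 s2 i' j' k' \<and>
        f (power_word s0 s1 s2 i j k) = (i' + w1 * j' + w2 * k') mod 5"
      unfolding f_def by (rule someI_ex) blast
    then obtain i' j' k' where eq: "power_word s0 s1 s2 i j k = power_word s0 s1 s2 i' j' k'"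
      and f: "f (power_word s0 s1 s2 i j k) = (i' + w1 * j' + w2 * k') mod 5"
      by blast
    have "5 dvd (i - i') + w1 * (j - j') + w2 * (k - k')"
      using w eq power_word_eq_iff[OF s] unfolding mod_five_weights_def by blast
    then have "(i + w1 * j + w2 * k) mod 5 = (i' + w1 * j' + w2 * k') mod 5"
      by (simp add: mod_eq_dvd_iff algebra_simps)
    with f show ?thesis by simp
  qed
  then show thesis
    using that by blast
qed

text \<open>As \<open>w t = t w^-1\<close>, the words and their t-translates are closed under left
  multiplication by \<open>S\<close>, hence exhaust the group; the t-translates lie outside
  \<open>A\<close>.\<close>

lemma connected_imp_power_word:
  assumes conn: "Digraph_Component.connected (cayley_graph G S)"
    and S: "S \<subseteq> carrier G" "\<And>s. s \<in> S \<Longrightarrow> inv s \<in> S"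
    and s: "s0 \<in> A" "s1 \<in> A" "s2 \<in> A"
    and sub: "\<And>x. x \<in> S \<Longrightarrow> \<exists>i j k. x = power_word s0 s1 s2 i j k \<or> x = t \<otimes> power_word s0 s1 s2 i j k"
    and x: "x \<in> A"
  obtains i j k where "x = power_word s0 s1 s2 i j k"
proof -
  let ?w = "power_word s0 s1 s2"
  have "\<exists>i j k. x = ?w i j k \<or> x = t \<otimes> ?w i j k"
    using conn S
  proof (rule cayley_graph_connected_induct[where x = x
        and P = "\<lambda>x. \<exists>i j k. x = ?w i j k \<or> x = t \<otimes> ?w i j k"])
    show "\<exists>i j k. \<one> = ?w i j k \<or> \<one> = t \<otimes> ?w i j k"
      using power_word_0 by metis
  next
    fix y x assume "y \<in> S" and x: "\<exists>i j k. x = ?w i j k \<or> x = t \<otimes> ?w i j k"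
    from sub[OF this(1)] obtain i j k where y: "y = ?w i j k \<or> y = t \<otimes> ?w i j k" by blast
    from x obtain i' j' k' where x: "x = ?w i' j' k' \<or> x = t \<otimes> ?w i' j' k'" by blast
    have comm: "?w i j k \<otimes> (t \<otimes> ?w i' j' k') = t \<otimes> ?w (i' - i) (j' - j) (k' - k)"
    proof -
      have "?w i j k \<otimes> (t \<otimes> ?w i' j' k') = ?w i j k \<otimes> t \<otimes> ?w i' j' k'"
        using s by (simp add: m_assoc)
      also have "\<dots> = t \<otimes> ?w (i' - i) (j' - j) (k' - k)"
        using s by (simp add: A_mult_t m_assoc power_word_inv power_word_mult)
      finally show ?thesis .
    qed
    have "y \<otimes> x \<in> {?w (i + i') (j + j') (k + k'), t \<otimes> ?w (i' - i) (j' - j) (k' - k),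
        t \<otimes> ?w (i + i') (j + j') (k + k'), ?w (i' - i) (j' - j) (k' - k)}"
      using x y s comm by (auto simp: m_assoc power_word_mult)
    then show "\<exists>i j k. y \<otimes> x = ?w i j k \<or> y \<otimes> x = t \<otimes> ?w i j k" by blast
  qed (simp_all add: \<open>x \<in> A\<close>)
  moreover have "x \<noteq> t \<otimes> ?w i j k" for i j k
    using t_mult_notin[of "?w i j k"] s x by auto
  ultimately show thesis
    using that by blast
qed

lemma mod_five_weights_imp_code_system_quadruple:
  assumes s: "s0 \<in> A" "s1 \<in> A" "s2 \<in> A" and dist: "distinct [\<one>, s0, s1, s2]"
    and word: "\<And>x. x \<in> A \<Longrightarrow> \<exists>i j k. x = power_word s0 s1 s2 i j k"
    and ab: "a \<in> {1, 2, 3}" "b \<in> {1, 2, 3}" "a \<noteq> b" and w: "mod_five_weights s0 s1 s2 (- a) (- b)"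
  shows "\<exists>D E. D \<subseteq> A \<and> E \<subseteq> A \<and> code_system {} {\<one>, s0, s1, s2} D E"
proof -
  let ?w = "power_word s0 s1 s2"
  obtain f where f: "\<And>i j k. f (?w i j k) = (i + - a * j + - b * k) mod 5"
    using ex_mod_five_function[OF s w] by blast
  text \<open>
    \<open>a + b - 1\<close> is the residue missed by \<open>0, 1, - a, - b\<close>, as all five residues sum to 0.
  \<close>
  define D where "D = {x \<in> A. f x = 0}"
  define E where "E = {x \<in> A. f x = (a + b - 1) mod 5}"
  have "code_system {} {\<one>, s0, s1, s2} D E"
    unfolding code_system_def
  proof
    fix x assume x: "x \<in> A"
    then obtain i j k where ijk: "x = ?w i j k"
      using word by blast
    define c where "c = i + - a * j + - b * k"
    note shift = power_word_shift[OF A_closed(1) s, of i j k, unfolded l_one[OF A_carrier[OF power_word_closed[OF s]]]]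
    have fx: "f x = c mod 5" "f (x \<otimes> s0) = (c + 1) mod 5" "f (x \<otimes> s1) = (c - a) mod 5" "f (x \<otimes> s2) = (c - b) mod 5"
      "f (x \<otimes> inv s0) = (c - 1) mod 5" "f (x \<otimes> inv s1) = (c + a) mod 5" "f (x \<otimes> inv s2) = (c + b) mod 5"
      unfolding ijk shift f c_def by (simp_all add: algebra_simps)
    define r where "r = c mod 5"
    have r: "r \<in> {0, 1, 2, 3, 4}"
      unfolding r_def by (rule residue_five)
    have fr: "f x = r" "f (x \<otimes> s0) = (r + 1) mod 5" "f (x \<otimes> s1) = (r - a) mod 5" "f (x \<otimes> s2) = (r - b) mod 5"
      "f (x \<otimes> inv s0) = (r - 1) mod 5" "f (x \<otimes> inv s1) = (r + a) mod 5" "f (x \<otimes> inv s2) = (r + b) mod 5"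
      unfolding fx r_def by (simp_all only: mod_add_left_eq mod_diff_left_eq)
    have mem: "x \<in> D \<longleftrightarrow> f x = 0" "x \<in> E \<longleftrightarrow> f x = (a + b - 1) mod 5" if "x \<in> A" for x
      using that unfolding D_def E_def by simp_all
    have "of_bool (x \<in> D) + of_bool (x \<in> E) + of_bool (x \<otimes> s0 \<in> E) + of_bool (x \<otimes> s1 \<in> E)
        + of_bool (x \<otimes> s2 \<in> E) = (1::nat)"
      "of_bool (x \<in> E) + of_bool (x \<in> D) + of_bool (x \<otimes> inv s0 \<in> D) + of_bool (x \<otimes> inv s1 \<in> D)
        + of_bool (x \<otimes> inv s2 \<in> D) = (1::nat)"
      unfolding mem[OF x] mem[OF A_closed(2)[OF x s(1)]] mem[OF A_closed(2)[OF x s(2)]] mem[OF A_closed(2)[OF x s(3)]]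
        mem[OF A_closed(2)[OF x A_closed(3)[OF s(1)]]] mem[OF A_closed(2)[OF x A_closed(3)[OF s(2)]]]
        mem[OF A_closed(2)[OF x A_closed(3)[OF s(3)]]] fr
      by (rule residue_count_quadruple[OF ab r])+
    then show "(\<Sum>b\<in>insert \<one> {}. of_bool (x \<otimes> b \<in> D)) + (\<Sum>c\<in>{\<one>, s0, s1, s2}. of_bool (x \<otimes> c \<in> E)) = (1::nat) \<and>
        (\<Sum>b\<in>insert \<one> {}. of_bool (x \<otimes> b \<in> E)) + (\<Sum>c\<in>{\<one>, s0, s1, s2}. of_bool (x \<otimes> inv c \<in> D)) = (1::nat)"
      using dist x by (simp add: ac_simps del: sum_of_bool_eq)
  qed
  moreover have "D \<subseteq> A" "E \<subseteq> A"
    unfolding D_def E_def by auto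
  ultimately show ?thesis
    by (intro exI conjI)
qed

lemma mod_five_weights_imp_code_system_cyclic_pair:
  assumes s: "s0 \<in> A" "s1 \<in> A" and dist: "distinct [\<one>, s1, inv s1]" "s0 \<noteq> \<one>"
    and word: "\<And>x. x \<in> A \<Longrightarrow> \<exists>i j k. x = power_word s0 s1 \<one> i j k"
    and w: "mod_five_weights s0 s1 \<one> w 0" and "w \<in> {1, -1}"
  shows "\<exists>D E. D \<subseteq> A \<and> E \<subseteq> A \<and> code_system {s1, inv s1} {\<one>, s0} D E"
proof -
  let ?w = "power_word s0 s1 \<one>"
  obtain f where f: "\<And>i j k. f (?w i j k) = (i + w * j + 0 * k) mod 5"
    using ex_mod_five_function[OF s A_closed(1) w] by blast
  define D where "D = {x \<in> A. f x = 0}"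
  \<comment> \<open>The closed neighbourhood of a point of \<open>A\<close> covers the residues 0,
    1, -1 inside \<open>A\<close>. The residues r and r - 1 for the part in \<open>E\<close> must be
    the remaining 3 and 2.\<close>
  define E where "E = {x \<in> A. f x = 3}"
  have "code_system {s1, inv s1} {\<one>, s0} D E"
    unfolding code_system_def
  proof
    fix x assume x: "x \<in> A"
    then obtain i j k where ijk: "x = ?w i j k"
      using word by blast
    define c where "c = i + w * j + 0 * k"
    note shift = power_word_shift[OF A_closed(1) s A_closed(1), of i j k,
        unfolded l_one[OF A_carrier[OF power_word_closed[OF s A_closed(1)]]]]
    have fx: "f x = c mod 5" "f (x \<otimes> s0) = (c + 1) mod 5" "f (x \<otimes> s1) = (c + w) mod 5"
      "f (x \<otimes> inv s0) = (c - 1) mod 5" "f (x \<otimes> inv s1) = (c - w) mod 5"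
      unfolding ijk shift f c_def by (simp_all add: algebra_simps)
    define r where "r = c mod 5"
    have r: "r \<in> {0, 1, 2, 3, 4}"
      unfolding r_def by (rule residue_five)
    have fr: "f x = r" "f (x \<otimes> s0) = (r + 1) mod 5" "f (x \<otimes> s1) = (r + w) mod 5"
      "f (x \<otimes> inv s0) = (r - 1) mod 5" "f (x \<otimes> inv s1) = (r - w) mod 5"
      unfolding fx r_def by (simp_all only: mod_add_left_eq mod_diff_left_eq)
    have mem: "x \<in> D \<longleftrightarrow> f x = 0" "x \<in> E \<longleftrightarrow> f x = 3" if "x \<in> A" for x
      using that unfolding D_def E_def by simp_all
    have "of_bool (x \<in> D) + of_bool (x \<otimes> s1 \<in> D) + of_bool (x \<otimes> inv s1 \<in> D) + of_bool (x \<in> E)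
        + of_bool (x \<otimes> s0 \<in> E) = (1::nat)"
      "of_bool (x \<in> E) + of_bool (x \<otimes> s1 \<in> E) + of_bool (x \<otimes> inv s1 \<in> E) + of_bool (x \<in> D)
        + of_bool (x \<otimes> inv s0 \<in> D) = (1::nat)"
      unfolding mem[OF x] mem[OF A_closed(2)[OF x s(1)]] mem[OF A_closed(2)[OF x s(2)]]
        mem[OF A_closed(2)[OF x A_closed(3)[OF s(1)]]] mem[OF A_closed(2)[OF x A_closed(3)[OF s(2)]]] fr
      by (rule residue_count_cyclic_pair[OF \<open>w \<in> {1, -1}\<close> r])+
    then show "(\<Sum>b\<in>insert \<one> {s1, inv s1}. of_bool (x \<otimes> b \<in> D)) + (\<Sum>c\<in>{\<one>, s0}. of_bool (x \<otimes> c \<in> E)) = (1::nat) \<and>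
        (\<Sum>b\<in>insert \<one> {s1, inv s1}. of_bool (x \<otimes> b \<in> E)) + (\<Sum>c\<in>{\<one>, s0}. of_bool (x \<otimes> inv c \<in> D)) = (1::nat)"
      using dist x by (simp add: ac_simps del: sum_of_bool_eq)
  qed
  moreover have "D \<subseteq> A" "E \<subseteq> A"
    unfolding D_def E_def by auto
  ultimately show ?thesis
    by (intro exI conjI)
qed

section \<open>The possible connection sets\<close>

lemma t_mult_eq_iff: "a \<in> A \<Longrightarrow> b \<in> A \<Longrightarrow> t \<otimes> a = t \<otimes> b \<longleftrightarrow> a = b" "a \<in> A \<Longrightarrow> t \<otimes> a = t \<longleftrightarrow> a = \<one>"
  "a \<in> A \<Longrightarrow> t = t \<otimes> a \<longleftrightarrow> a = \<one>"
  using l_cancel_one[of t a] l_cancel_one'[of t a] by simp_all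

lemma connection_set_quadruple:
  assumes s: "s0 \<in> A" "s1 \<in> A" "s2 \<in> A" and S: "S = {t, t \<otimes> s0, t \<otimes> s1, t \<otimes> s2}" and "card S = 4"
  shows "S \<inter> A = {}" and "{c \<in> A. t \<otimes> c \<in> S} = {\<one>, s0, s1, s2}" and "distinct [\<one>, s0, s1, s2]"
proof -
  show "S \<inter> A = {}"
    unfolding S using s t_notin t_mult_notin by auto
  show "{c \<in> A. t \<otimes> c \<in> S} = {\<one>, s0, s1, s2}"
    unfolding S using s by (auto simp: t_mult_eq_iff)
  have "card (set [t, t \<otimes> s0, t \<otimes> s1, t \<otimes> s2]) = length [t, t \<otimes> s0, t \<otimes> s1, t \<otimes> s2]"
    using \<open>card S = 4\<close> unfolding S by simp
  then have "distinct [t, t \<otimes> s0, t \<otimes> s1, t \<otimes> s2]"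
    by (rule card_distinct)
  then show "distinct [\<one>, s0, s1, s2]"
    using s by (auto simp: t_mult_eq_iff)
qed

lemma connection_set_cyclic_pair:
  assumes s: "s0 \<in> A" "s1 \<in> A" and S: "S = {s1, inv s1, t, t \<otimes> s0}" and "card S = 4" and "\<one> \<notin> S"
  shows "S \<inter> A = {s1, inv s1}" and "{c \<in> A. t \<otimes> c \<in> S} = {\<one>, s0}" and "distinct [\<one>, s1, inv s1]" and "s0 \<noteq> \<one>"
proof -
  show "S \<inter> A = {s1, inv s1}"
    unfolding S using s t_notin t_mult_notin by auto
  have "t \<otimes> c \<noteq> s1" "t \<otimes> c \<noteq> inv s1" if "c \<in> A" for c
    using t_mult_notin[OF that] s by auto
  then show "{c \<in> A. t \<otimes> c \<in> S} = {\<one>, s0}"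
    unfolding S using s by (auto simp: t_mult_eq_iff)
  have "card (set [s1, inv s1, t, t \<otimes> s0]) = length [s1, inv s1, t, t \<otimes> s0]"
    using \<open>card S = 4\<close> unfolding S by simp
  then have "distinct [s1, inv s1, t, t \<otimes> s0]"
    by (rule card_distinct)
  then show "distinct [\<one>, s1, inv s1]" "s0 \<noteq> \<one>"
    using s \<open>\<one> \<notin> S\<close> unfolding S by (auto simp: t_mult_eq_iff)
qed

end

context generalized_dihedral
begin

text \<open>Inversion acts on \<open>B\<close>, and \<open>B\<close> and \<open>C\<close> together
  have three elements. A one-element \<open>B\<close> consists of an involution; a two-element
  \<open>B\<close> is an inverse pair or consists of two involutions; a three-element
  \<open>B\<close> contains one or three involutions. A code survives only for an empty
  \<open>B\<close> or an inverse pair.\<close>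

lemma connection_set_cases:
  assumes S: "S \<subseteq> carrier G - {\<one>}" "\<And>s. s \<in> S \<Longrightarrow> inv s \<in> S" and "card S = 4" and "t \<in> S"
    and code: "code_system (S \<inter> A) {c \<in> A. t \<otimes> c \<in> S} D E"
  obtains s0 s1 where "s0 \<in> A" "s1 \<in> A" "S = {s1, inv s1, t, t \<otimes> s0}"
    | s0 s1 s2 where "s0 \<in> A" "s1 \<in> A" "s2 \<in> A" "S = {t, t \<otimes> s0, t \<otimes> s1, t \<otimes> s2}"
proof -
  define B where "B = S \<inter> A"
  define C where "C = {c \<in> A. t \<otimes> c \<in> S} - {\<one>}"
  have fin: "finite S"
    using \<open>card S = 4\<close> card.infinite by fastforce
  have BC: "{c \<in> A. t \<otimes> c \<in> S} = insert \<one> C"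
    using \<open>t \<in> S\<close> unfolding C_def by auto
  have B: "inv b \<in> B" "b \<noteq> \<one>" "b \<in> A" "inv b \<in> A" "inv (inv b) = b" if "b \<in> B" for b
    using that S unfolding B_def by auto
  have C: "C \<subseteq> A" "\<one> \<notin> C"
    unfolding C_def by auto
  have union: "S = B \<union> insert t ((\<otimes>) t ` C)"
  proof (intro equalityI subsetI)
    fix s assume "s \<in> S"
    then have "s \<in> carrier G"
      using S(1) by blast
    then show "s \<in> B \<union> insert t ((\<otimes>) t ` C)"
      by (rule carrier_cases) (use \<open>s \<in> S\<close> in \<open>auto simp: B_def C_def\<close>)
  qed (use \<open>t \<in> S\<close> in \<open>auto simp: B_def C_def\<close>)
  have inj: "inj_on ((\<otimes>) t) C"
    by (intro inj_onI) (use C in \<open>auto simp: t_mult_eq_iff subset_iff\<close>)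
  have image: "finite ((\<otimes>) t ` C)" and finB: "finite B"
    using fin union by (metis finite_Un finite_insert)+
  have "t \<notin> (\<otimes>) t ` C"
    using C by (auto simp: t_mult_eq_iff subset_iff)
  moreover have "B \<inter> insert t ((\<otimes>) t ` C) = {}"
    using t_notin t_mult_notin C(1) unfolding B_def by blast
  ultimately have "card (B \<union> insert t ((\<otimes>) t ` C)) = card B + Suc (card C)"
    using image finB by (simp add: card_Un_disjoint card_image[OF inj])
  then have card: "card B + card C = 3"
    using \<open>card S = 4\<close> unfolding union[symmetric] by simp
  have code: "code_system B (insert \<one> C) D E"
    using code unfolding B_def BC .
  consider "card C = 3" "card B = 0" | "card C = 2" "card B = 1" | "card C = 1" "card B = 2" | "card C = 0" "card B = 3"
    using card by linarith
  then show thesis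
  proof cases
    case 1
    then obtain s0 s1 s2 where "C = {s0, s1, s2}" "B = {}"
      using finB by (auto simp: card_3_iff)
    then show ?thesis
      using C(1) by (intro that(2)[of s0 s1 s2]) (simp_all add: union)
  next
    case 2
    then obtain b s0 s1 where B': "B = {b}" and C': "C = {s0, s1}" "s0 \<noteq> s1"
      by (auto simp: card_1_singleton_iff card_2_iff)
    then show ?thesis
      using no_code_system_involution_triple[of b s0 s1 D E] code B[of b] C by auto
  next
    case 3
    then obtain b1 b2 s0 where B': "B = {b1, b2}" "b1 \<noteq> b2" and C': "C = {s0}"
      by (auto simp: card_1_singleton_iff card_2_iff)
    have s: "b1 \<in> A" "b2 \<in> A" "s0 \<in> A" "b1 \<noteq> \<one>" "b2 \<noteq> \<one>" "s0 \<noteq> \<one>"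
      using B(2,3) C unfolding B' C' by auto
    have inv: "inv b1 \<in> {b1, b2}" "inv b2 \<in> {b1, b2}" "inv (inv b1) = b1" "inv (inv b2) = b2"
      using B(1,5) unfolding B' by auto
    show ?thesis
    proof (cases "inv b1 = b1")
      case True
      then have "inv b2 = b2"
        using inv(2,4) \<open>b1 \<noteq> b2\<close> by (metis insertE singletonD)
      then have False
        using no_code_system_two_involutions[of b1 b2 s0 D E] code s True \<open>b1 \<noteq> b2\<close> unfolding B' C' by auto
      then show ?thesis ..
    next
      case False
      then have "inv b1 = b2"
        using inv(1) by blast
      then have "S = {b1, inv b1, t, t \<otimes> s0}"
        using union unfolding B' C' by auto
      then show ?thesis
        using that(1) s by blast
    qed
  next
    case 4
    then have C': "C = {}"
      using image finite_imageD[OF _ inj] by simp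
    have False
    proof (cases "\<exists>a\<in>B. inv a \<noteq> a")
      case True
      then obtain a where a: "a \<in> B" "inv a \<noteq> a" by blast
      \<comment> \<open>Inversion exchanges \<open>a\<close> and \<open>inv a\<close>, so it must
        fix the one element that remains.\<close>
      then have "card (B - {a, inv a}) = 1"
        using 4 B(1)[of a] finB by (subst card_Diff_subset) auto
      then obtain b where b: "B - {a, inv a} = {b}"
        by (auto simp: card_1_singleton_iff)
      then have B': "B = {a, inv a, b}" and b: "b \<in> B" "b \<noteq> a" "b \<noteq> inv a"
        using a B(1)[of a] by blast+
      have "inv b \<noteq> a" "inv b \<noteq> inv a"
        using b B(5)[OF a(1)] B(5)[OF b(1)] by metis+
      then have "inv b = b"
        using B(1)[OF b(1)] B' by blast
      moreover have "distinct [\<one>, a, inv a, b]"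
        using a b B(2)[OF a(1)] B(2)[OF b(1)] B(2)[OF B(1)[OF a(1)]] by auto
      ultimately show ?thesis
        using no_code_system_involution_cyclic[of a b D E] code B(3)[OF a(1)] B(3)[OF b(1)] unfolding B' C' by blast
    next
      case False
      obtain b1 b2 b3 where B': "B = {b1, b2, b3}" and d: "b1 \<noteq> b2" "b2 \<noteq> b3" "b1 \<noteq> b3"
        using 4 unfolding card_3_iff by blast
      have "distinct [\<one>, b1, b2, b3]"
        using d B(2) unfolding B' by auto
      then show ?thesis
        using no_code_system_three_involutions[of b1 b2 b3 D E] code B(3) False unfolding B' C' by blast
    qed
    then show ?thesis ..
  qed
qed

end

theorem theorem1p1:
  fixes G :: "('a, 'b) monoid_scheme" (structure)
    and A S :: "'a set" and t :: 'a
  assumes "generalized_dihedral G A t"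
    and "S \<subseteq> carrier G - {\<one>}"
    and "\<forall>s\<in>S. inv s \<in> S"
    and "card S = 4"
    and "t \<in> S"
    and "Digraph_Component.connected (cayley_graph G S)"
  shows "(\<exists>D. perfect_code (cayley_graph G S) D) \<longleftrightarrow>
    (\<exists>s0\<in>A. \<exists>s1\<in>A. S = {s1, inv s1, t, t \<otimes> s0} \<and>
       (let n = group.ord G s0;
            m = least_exponent_into G s1 (generate G {s0})
        in 5 dvd n \<and>
           (\<exists>u \<in> {2 * i | i::nat. i \<le> n div 5 - 1}.
              s1 [^] m = s0 [^] (5 * int u div 2 + int m) \<or>
              s1 [^] m = s0 [^] (5 * int u div 2 - int m))))
    \<or>
    (\<exists>s0\<in>A. \<exists>s1\<in>A. \<exists>s2\<in>A. S = {t, t \<otimes> s0, t \<otimes> s1, t \<otimes> s2} \<and>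
       (let n = group.ord G s0;
            m = least_exponent_into G s1 (generate G {s0});
            l = least_exponent_into G s2 (generate G {s0, s1})
        in 5 dvd n \<and>
           (\<exists>v \<in> {2, 3, 4 :: int}. \<exists>a b :: int.
              {a, b} = {2 + parity_sigma v, v - parity_sigma v - 1} \<and>
              (\<exists>\<alpha>\<^sub>1 \<in> {0..n div 5 - 1}. \<exists>\<alpha>\<^sub>2 \<in> {0..n div 5 - 1}. \<exists>j \<in> {0..m - 1}.
                 s1 [^] m = s0 [^] (5 * int \<alpha>\<^sub>1 - a * int m) \<and>
                 s2 [^] l = s0 [^] (5 * int \<alpha>\<^sub>2 - b * int l + a * int j) \<otimes> s1 [^] j))))"
    (is "?code \<longleftrightarrow> (\<exists>s0\<in>A. \<exists>s1\<in>A. S = _ s1 s0 \<and> ?P s0 s1) \<or> (\<exists>s0\<in>A. \<exists>s1\<in>A. \<exists>s2\<in>A. S = _ s0 s1 s2 \<and> ?Q s0 s1 s2)")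
proof -
  interpret generalized_dihedral G A t by fact
  have S: "S \<subseteq> carrier G - {\<one>}" "\<And>s. s \<in> S \<Longrightarrow> inv s \<in> S"
    using assms by auto
  have P: "?P s0 s1 \<longleftrightarrow> mod_five_weights s0 s1 \<one> 1 0 \<or> mod_five_weights s0 s1 \<one> (- 1) 0"
    if "s0 \<in> A" "s1 \<in> A" for s0 s1
    by (rule mod_five_weights_cyclic_pair_iff[OF that])
  have Q: "?Q s0 s1 s2 \<longleftrightarrow> (\<exists>a\<in>{1, 2, 3}. \<exists>b\<in>{1, 2, 3}. a \<noteq> b \<and> mod_five_weights s0 s1 s2 (- a) (- b))"
    if "s0 \<in> A" "s1 \<in> A" "s2 \<in> A" for s0 s1 s2
    unfolding mod_five_weights_triple_iff[OF that, symmetric] pair_parity_sigma_iff Let_def by blast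
  have code_iff: "?code \<longleftrightarrow> (\<exists>D E. D \<subseteq> A \<and> E \<subseteq> A \<and> code_system (S \<inter> A) {c \<in> A. t \<otimes> c \<in> S} D E)"
    by (rule ex_perfect_code_iff) (use S in auto)
  have S': "S \<subseteq> carrier G"
    using S(1) by blast
  show ?thesis
  proof
    assume ?code
    from this[unfolded code_iff]
    obtain D E where DE: "D \<subseteq> A" "E \<subseteq> A" and code: "code_system (S \<inter> A) {c \<in> A. t \<otimes> c \<in> S} D E"
      by (elim exE conjE)
    from S assms(4,5) code
    show "(\<exists>s0\<in>A. \<exists>s1\<in>A. S = {s1, inv s1, t, t \<otimes> s0} \<and> ?P s0 s1) \<or>
      (\<exists>s0\<in>A. \<exists>s1\<in>A. \<exists>s2\<in>A. S = {t, t \<otimes> s0, t \<otimes> s1, t \<otimes> s2} \<and> ?Q s0 s1 s2)"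
    proof (rule connection_set_cases)
      fix s0 s1 assume s: "s0 \<in> A" "s1 \<in> A" and eq: "S = {s1, inv s1, t, t \<otimes> s0}"
      have "\<one> \<notin> S"
        using S(1) by blast
      note shape = connection_set_cyclic_pair[OF s eq assms(4) this]
      have "?P s0 s1"
        unfolding P[OF s]
        using code_system_cyclic_pair[OF code[unfolded shape(1,2)] DE s shape(3,4)] .
      with s eq show ?thesis
        by (intro disjI1 bexI[of _ s0] bexI[of _ s1] conjI)
    next
      fix s0 s1 s2 assume s: "s0 \<in> A" "s1 \<in> A" "s2 \<in> A" and eq: "S = {t, t \<otimes> s0, t \<otimes> s1, t \<otimes> s2}"
      note shape = connection_set_quadruple[OF s eq assms(4)]
      have "?Q s0 s1 s2"
        unfolding Q[OF s]
        using code_system_quadruple[OF code[unfolded shape(1,2)] DE s shape(3)] by blast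
      with s eq show ?thesis
        by (intro disjI2 bexI[of _ s0] bexI[of _ s1] bexI[of _ s2] conjI)
    qed
  next
    assume "(\<exists>s0\<in>A. \<exists>s1\<in>A. S = {s1, inv s1, t, t \<otimes> s0} \<and> ?P s0 s1) \<or>
      (\<exists>s0\<in>A. \<exists>s1\<in>A. \<exists>s2\<in>A. S = {t, t \<otimes> s0, t \<otimes> s1, t \<otimes> s2} \<and> ?Q s0 s1 s2)"
    then show ?code
    proof (elim disjE bexE conjE)
      fix s0 s1 assume s: "s0 \<in> A" "s1 \<in> A" and eq: "S = {s1, inv s1, t, t \<otimes> s0}" and "?P s0 s1"
      then obtain w where w: "w \<in> {1, -1}" "mod_five_weights s0 s1 \<one> w 0"
        unfolding P[OF s] by blast
      have "\<one> \<notin> S"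
        using S(1) by blast
      note shape = connection_set_cyclic_pair[OF s eq assms(4) this]
      \<comment> \<open>Through connectedness this makes every element of \<open>A\<close> a word,
        so that the weights define the code on all of \<open>A\<close>.\<close>
      have sub: "\<exists>i j k. x = power_word s0 s1 \<one> i j k \<or> x = t \<otimes> power_word s0 s1 \<one> i j k" if "x \<in> S" for x
      proof -
        have "s1 = power_word s0 s1 \<one> 0 1 0" "inv s1 = power_word s0 s1 \<one> 0 (- 1) 0"
          "t = t \<otimes> power_word s0 s1 \<one> 0 0 0" "t \<otimes> s0 = t \<otimes> power_word s0 s1 \<one> 1 0 0"
          using s power_word_inv[of s0 s1 \<one> 0 1 0] by (simp_all add: power_word_generators)
        then show ?thesis
          using that unfolding eq by blast
      qed
      have "\<exists>i j k. x = power_word s0 s1 \<one> i j k" if "x \<in> A" for x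
        by (rule connected_imp_power_word[OF assms(6) S' S(2) s A_closed(1) sub that]) blast+
      from mod_five_weights_imp_code_system_cyclic_pair[OF s shape(3,4) this w(2,1)]
      show ?code
        unfolding code_iff shape(1,2) .
    next
      fix s0 s1 s2 assume s: "s0 \<in> A" "s1 \<in> A" "s2 \<in> A" and eq: "S = {t, t \<otimes> s0, t \<otimes> s1, t \<otimes> s2}"
        and "?Q s0 s1 s2"
      then obtain a b where ab: "a \<in> {1, 2, 3}" "b \<in> {1, 2, 3}" "a \<noteq> b" and w: "mod_five_weights s0 s1 s2 (- a) (- b)"
        unfolding Q[OF s] by blast
      note shape = connection_set_quadruple[OF s eq assms(4)]
      have sub: "\<exists>i j k. x = power_word s0 s1 s2 i j k \<or> x = t \<otimes> power_word s0 s1 s2 i j k" if "x \<in> S" for x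
      proof -
        have "t = t \<otimes> power_word s0 s1 s2 0 0 0" "t \<otimes> s0 = t \<otimes> power_word s0 s1 s2 1 0 0"
          "t \<otimes> s1 = t \<otimes> power_word s0 s1 s2 0 1 0" "t \<otimes> s2 = t \<otimes> power_word s0 s1 s2 0 0 1"
          using s by (simp_all add: power_word_generators)
        then show ?thesis
          using that unfolding eq by blast
      qed
      have "\<exists>i j k. x = power_word s0 s1 s2 i j k" if "x \<in> A" for x
        by (rule connected_imp_power_word[OF assms(6) S' S(2) s sub that]) blast+
      from mod_five_weights_imp_code_system_quadruple[OF s shape(3) this ab w]
      show ?code
        unfolding code_iff shape(1,2) .
    qed
  qed
qed

end
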